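(* Let $(A,\circ)$ be a finite-dimensional Novikov algebra over $\Bbbk$ and let $D\in\operatorname{Der}(A,\circ)$ be a derivation of $(A,\circ)$. Define $[x,y]:=D(x)\circ y-D(y)\circ x$ for all $x,y\in A$. Then $(A,\circ,[\cdot,\cdot])$ is a special GD algebra.
   Context: $\Bbbk$ is an algebraically closed field of characteristic $0$. A Novikov algebra is a vector space with a bilinear product $\circ$ satisfying $(x\circ y)\circ z-x\circ(y\circ z)=(y\circ x)\circ z-y\circ(x\circ z)$ and $(x\circ y)\circ z=(x\circ z)\circ y$. A Gelfand--Dorfman (GD) algebra is a triple $(A,\circ,[\cdot,\cdot])$ such that $(A,\circ)$ is a Novikov algebra, $(A,[\cdot,\cdot])$ is a Lie algebra, and for all $x,y,z\in A$: $[x,y\circ z]-[z,y\circ x]+[y,x]\circ z-[y,z]\circ x-y\circ[x,z]=0$. A differential Poisson algebra $(P,\cdot,\{\cdot,\cdot\},d)$ is a Poisson algebra (with commutative associative product $\cdot$; not required to be finite-dimensional) with a linear map $d$ that is a derivation of both $\cdot$ and $\{\cdot,\cdot\}$. It induces a GD algebra $P^{(d)}$ on $P$ by $[u,v]=\{u,v\}$, $u\circ v=u\cdot d(v)$. A GD algebra is special if it is isomorphic to a GD subalgebra of $P^{(d)}$ for some differential Poisson algebra $P$. *)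

theory Defs
  imports "HOL-Computational_Algebra.Polynomial" "HOL-Library.Poly_Mapping"
begin

definition bilinear_op :: "('k::field \<Rightarrow> 'a::ab_group_add \<Rightarrow> 'a) \<Rightarrow> ('a \<Rightarrow> 'a \<Rightarrow> 'a) \<Rightarrow> bool" where
  "bilinear_op scale f \<longleftrightarrow>
     (\<forall>x. Vector_Spaces.linear scale scale (f x)) \<and>
     (\<forall>y. Vector_Spaces.linear scale scale (\<lambda>x. f x y))"

definition derivation_of ::
  "('k::field \<Rightarrow> 'a::ab_group_add \<Rightarrow> 'a) \<Rightarrow> ('a \<Rightarrow> 'a \<Rightarrow> 'a) \<Rightarrow> ('a \<Rightarrow> 'a) \<Rightarrow> bool" where
  "derivation_of scale f D \<longleftrightarrow>
     Vector_Spaces.linear scale scale D \<and> (\<forall>x y. D (f x y) = f (D x) y + f x (D y))"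

locale novikov_algebra = vector_space scale
  for scale :: "'k::field \<Rightarrow> 'a::ab_group_add \<Rightarrow> 'a" +
  fixes circ :: "'a \<Rightarrow> 'a \<Rightarrow> 'a"
  assumes circ_bilinear: "bilinear_op scale circ"
    and circ_left_symmetric:
      "circ (circ x y) z - circ x (circ y z) = circ (circ y x) z - circ y (circ x z)"
    and circ_right_commutative: "circ (circ x y) z = circ (circ x z) y"

locale lie_algebra = vector_space scale
  for scale :: "'k::field \<Rightarrow> 'a::ab_group_add \<Rightarrow> 'a" +
  fixes br :: "'a \<Rightarrow> 'a \<Rightarrow> 'a"
  assumes br_bilinear: "bilinear_op scale br"
    and br_self: "br x x = 0"
    and br_jacobi: "br x (br y z) + br y (br z x) + br z (br x y) = 0"

locale GD_algebra =
  novikov_algebra scale circ + lie_algebra scale br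
  for scale :: "'k::field \<Rightarrow> 'a::ab_group_add \<Rightarrow> 'a"
    and circ br :: "'a \<Rightarrow> 'a \<Rightarrow> 'a" +
  assumes GD_compat:
    "br x (circ y z) - br z (circ y x) + circ (br y x) z - circ (br y z) x - circ y (br x z) = 0"

text \<open>The commutative product is not required to have a unit.\<close>

locale poisson_algebra = lie_algebra scale pb
  for scale :: "'k::field \<Rightarrow> 'p::ab_group_add \<Rightarrow> 'p"
    and pb :: "'p \<Rightarrow> 'p \<Rightarrow> 'p" +
  fixes dot :: "'p \<Rightarrow> 'p \<Rightarrow> 'p"
  assumes dot_bilinear: "bilinear_op scale dot"
    and dot_commute: "dot x y = dot y x"
    and dot_assoc: "dot (dot x y) z = dot x (dot y z)"
    and pb_leibniz: "pb x (dot y z) = dot (pb x y) z + dot y (pb x z)"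

locale differential_poisson_algebra = poisson_algebra scale pb dot
  for scale :: "'k::field \<Rightarrow> 'p::ab_group_add \<Rightarrow> 'p"
    and pb dot :: "'p \<Rightarrow> 'p \<Rightarrow> 'p" +
  fixes d :: "'p \<Rightarrow> 'p"
  assumes d_mult: "derivation_of scale dot d"
    and d_pb: "derivation_of scale pb d"

text \<open>The product of $P^{(d)}$; its bracket is the Poisson bracket.\<close>

definition induced_circ :: "('p \<Rightarrow> 'p \<Rightarrow> 'p) \<Rightarrow> ('p \<Rightarrow> 'p) \<Rightarrow> 'p \<Rightarrow> 'p \<Rightarrow> 'p" where
  "induced_circ dot d u v = dot u (d v)"

definition GD_subalgebra ::
  "('k::field \<Rightarrow> 'p::ab_group_add \<Rightarrow> 'p) \<Rightarrow> ('p \<Rightarrow> 'p \<Rightarrow> 'p) \<Rightarrow> ('p \<Rightarrow> 'p \<Rightarrow> 'p) \<Rightarrow> 'p set \<Rightarrow> bool" where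
  "GD_subalgebra scale circ br S \<longleftrightarrow>
     module.subspace scale S \<and> (\<forall>u\<in>S. \<forall>v\<in>S. circ u v \<in> S \<and> br u v \<in> S)"

definition GD_isomorphism_onto ::
  "('k::field \<Rightarrow> 'a::ab_group_add \<Rightarrow> 'a) \<Rightarrow> ('a \<Rightarrow> 'a \<Rightarrow> 'a) \<Rightarrow> ('a \<Rightarrow> 'a \<Rightarrow> 'a) \<Rightarrow>
   ('k \<Rightarrow> 'p::ab_group_add \<Rightarrow> 'p) \<Rightarrow> ('p \<Rightarrow> 'p \<Rightarrow> 'p) \<Rightarrow> ('p \<Rightarrow> 'p \<Rightarrow> 'p) \<Rightarrow>
   'p set \<Rightarrow> ('a \<Rightarrow> 'p) \<Rightarrow> bool" where
  "GD_isomorphism_onto scale circ br scale' circ' br' S f \<longleftrightarrow>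
     Vector_Spaces.linear scale scale' f \<and> bij_betw f UNIV S \<and>
     (\<forall>x y. f (circ x y) = circ' (f x) (f y)) \<and> (\<forall>x y. f (br x y) = br' (f x) (f y))"

text \<open>HOL cannot quantify over the carrier type of the differential Poisson algebra inside a
  formula, so the definition of special names one type: the formal linear combinations of words in
  elements of the algebra, built with two binary operations and one unary operation. This loses
  nothing: the lemma \<open>special_GD_algebraI\<close> below shows that an
  embedding into $P^{(d)}$ for a differential Poisson algebra on any type whatsoever is
  enough.\<close>

datatype 'a dp_word =
    Gen 'a
  | Mul "'a dp_word" "'a dp_word"
  | Brk "'a dp_word" "'a dp_word"
  | Dif "'a dp_word"

definition special_GD_algebra ::
  "('k::field \<Rightarrow> 'a::ab_group_add \<Rightarrow> 'a) \<Rightarrow> ('a \<Rightarrow> 'a \<Rightarrow> 'a) \<Rightarrow> ('a \<Rightarrow> 'a \<Rightarrow> 'a) \<Rightarrow> bool" where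
  "special_GD_algebra scale circ br \<longleftrightarrow>
     GD_algebra scale circ br \<and>
     (\<exists>(scaleP :: 'k \<Rightarrow> ('a dp_word \<Rightarrow>\<^sub>0 'k) \<Rightarrow> ('a dp_word \<Rightarrow>\<^sub>0 'k)) pb dot d S f.
        differential_poisson_algebra scaleP pb dot d \<and>
        GD_subalgebra scaleP (induced_circ dot d) pb S \<and>
        GD_isomorphism_onto scale circ br scaleP (induced_circ dot d) pb S f)"

lemma bilinear_op_iff:
  "bilinear_op scale f \<longleftrightarrow> vector_space scale \<and>
     (\<forall>x y z. f x (y + z) = f x y + f x z) \<and> (\<forall>x y z. f (x + y) z = f x z + f y z) \<and>
     (\<forall>c x y. f x (scale c y) = scale c (f x y)) \<and> (\<forall>c x y. f (scale c x) y = scale c (f x y))"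
  unfolding bilinear_op_def Vector_Spaces.linear_iff by auto

definition word_scale :: "'k::field \<Rightarrow> ('w \<Rightarrow>\<^sub>0 'k) \<Rightarrow> ('w \<Rightarrow>\<^sub>0 'k)" where
  "word_scale c p = Poly_Mapping.map ((*) c) p"

lemma lookup_word_scale: "Poly_Mapping.lookup (word_scale c p) w = c * Poly_Mapping.lookup p w"
  unfolding word_scale_def by transfer (simp add: when_def)

lemma vector_space_word_scale: "vector_space word_scale"
  by standard (auto intro!: poly_mapping_eqI simp: lookup_word_scale lookup_add algebra_simps)

primrec word_eval ::
  "('p \<Rightarrow> 'p \<Rightarrow> 'p) \<Rightarrow> ('p \<Rightarrow> 'p \<Rightarrow> 'p) \<Rightarrow> ('p \<Rightarrow> 'p) \<Rightarrow> ('a \<Rightarrow> 'p) \<Rightarrow> 'a dp_word \<Rightarrow> 'p" where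
  "word_eval dot pb d f (Gen x) = f x"
| "word_eval dot pb d f (Mul s t) = dot (word_eval dot pb d f s) (word_eval dot pb d f t)"
| "word_eval dot pb d f (Brk s t) = pb (word_eval dot pb d f s) (word_eval dot pb d f t)"
| "word_eval dot pb d f (Dif s) = d (word_eval dot pb d f s)"

lemma bilinear_op_span_closed:
  assumes b: "bilinear_op scale f" and G: "\<And>x y. x \<in> G \<Longrightarrow> y \<in> G \<Longrightarrow> f x y \<in> G"
    and x: "x \<in> module.span scale G" and y: "y \<in> module.span scale G"
  shows "f x y \<in> module.span scale G"
proof -
  interpret vector_space scale using b by (simp add: bilinear_op_iff)
  have f_add: "f u (v + w) = f u v + f u w" "f (u + v) w = f u w + f v w" for u v w
    using b by (auto simp: bilinear_op_iff)
  have f_scale: "f u (scale c v) = scale c (f u v)" "f (scale c u) v = scale c (f u v)" for u v c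
    using b by (auto simp: bilinear_op_iff)
  have f_zero: "f u 0 = 0" "f 0 u = 0" for u
    using f_add(1)[of u 0 0] f_add(2)[of 0 0 u] by simp_all
  have 1: "f u v \<in> span G" if u: "u \<in> G" and v: "v \<in> span G" for u v
    using v
  proof (induction rule: span_induct)
    case base
    show ?case unfolding subspace_def mem_Collect_eq
      by (simp add: f_add f_scale f_zero span_zero span_add span_scale)
  next
    case (step v)
    show ?case by (rule span_base, rule G, rule u, rule step)
  qed
  show ?thesis using x
  proof (induction rule: span_induct)
    case base
    show ?case unfolding subspace_def mem_Collect_eq
      by (simp add: f_add f_scale f_zero span_zero span_add span_scale)
  next
    case (step u)
    show ?case by (rule 1[OF step y])
  qed
qed

theorem special_GD_algebraI:
  fixes scale :: "'k::field \<Rightarrow> 'a::ab_group_add \<Rightarrow> 'a"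
    and scaleP :: "'k \<Rightarrow> 'p::ab_group_add \<Rightarrow> 'p"
  assumes GD: "GD_algebra scale circ br"
    and P: "differential_poisson_algebra scaleP pb dot d"
    and S: "GD_subalgebra scaleP (induced_circ dot d) pb S"
    and iso: "GD_isomorphism_onto scale circ br scaleP (induced_circ dot d) pb S f"
  shows "special_GD_algebra scale circ br"
proof -
  interpret P: differential_poisson_algebra scaleP pb dot d by fact
  interpret VP: vector_space_pair word_scale scaleP
    by (intro vector_space_pair.intro vector_space_word_scale P.vector_space_axioms)
  define ev where "ev = word_eval dot pb d f"
  define G where "G = range ev"
  define W where "W = P.span G"
  define E where "E = (\<lambda>p. \<Sum>w\<in>Poly_Mapping.keys p. scaleP (Poly_Mapping.lookup p w) (ev w))"
  have E_sup: "E p = (\<Sum>w\<in>A. scaleP (Poly_Mapping.lookup p w) (ev w))" if "finite A"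
    "Poly_Mapping.keys p \<subseteq> A" for p A
    unfolding E_def using that by (intro sum.mono_neutral_left) (auto simp: in_keys_iff)
  have E_add: "E (p + q) = E p + E q" for p q
  proof -
    let ?A = "Poly_Mapping.keys p \<union> Poly_Mapping.keys q"
    have "E (p + q) = (\<Sum>w\<in>?A. scaleP (Poly_Mapping.lookup (p + q) w) (ev w))"
      by (rule E_sup) (use Poly_Mapping.keys_add[of p q] in auto)
    also have "\<dots> = (\<Sum>w\<in>?A. scaleP (Poly_Mapping.lookup p w) (ev w)) +
      (\<Sum>w\<in>?A. scaleP (Poly_Mapping.lookup q w) (ev w))"
      by (simp add: lookup_add P.scale_left_distrib sum.distrib)
    also have "\<dots> = E p + E q"
      by (subst (1 2) E_sup[of ?A]) auto
    finally show ?thesis .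
  qed
  have E_scale: "E (word_scale c p) = scaleP c (E p)" for c p
  proof -
    have "E (word_scale c p) = (\<Sum>w\<in>Poly_Mapping.keys p. scaleP (Poly_Mapping.lookup (word_scale c p) w) (ev w))"
      by (rule E_sup) (auto simp: in_keys_iff lookup_word_scale)
    also have "\<dots> = scaleP c (E p)"
      by (simp add: E_def lookup_word_scale P.scale_sum_right)
    finally show ?thesis .
  qed
  have E_lin: "Vector_Spaces.linear word_scale scaleP E"
    unfolding Vector_Spaces.linear_iff
    using vector_space_word_scale P.vector_space_axioms E_add E_scale by auto
  have E_W: "E p \<in> W" for p
    unfolding E_def W_def G_def by (intro P.span_sum P.span_scale P.span_base) auto
  have "ev w \<in> range E" for w
  proof -
    have "E (Poly_Mapping.single w 1) = ev w" by (simp add: E_def)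
    then show ?thesis by (metis rangeI)
  qed
  moreover have "P.subspace (range E)"
    using VP.linear_subspace_image[OF E_lin VP.vs1.subspace_UNIV] .
  ultimately have W_range: "W \<subseteq> range E"
    unfolding W_def G_def by (intro P.span_minimal) auto
  obtain s where s_lin: "Vector_Spaces.linear scaleP word_scale s"
    and s: "\<And>v. v \<in> W \<Longrightarrow> E (s v) = v"
    using VP.linear_exists_right_inverse_on[OF E_lin VP.vs1.subspace_UNIV] W_range by blast
  have s_add: "s (x + y) = s x + s y" and s_scale: "s (scaleP c x) = word_scale c (s x)" for x y c
    using s_lin unfolding Vector_Spaces.linear_iff by auto
  have s_zero: "s 0 = 0"
    using s_add[of 0 0] by simp
  have d_lin: "d (x + y) = d x + d y" "d (scaleP c x) = scaleP c (d x)" for x y c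
    using P.d_mult unfolding derivation_of_def Vector_Spaces.linear_iff by auto
  have d_prod: "d (dot x y) = dot (d x) y + dot x (d y)"
      "d (pb x y) = pb (d x) y + pb x (d y)" for x y
    using P.d_mult P.d_pb unfolding derivation_of_def by auto
  have dot_lin: "dot x (y + z) = dot x y + dot x z" "dot (x + y) z = dot x z + dot y z"
      "dot x (scaleP c y) = scaleP c (dot x y)" "dot (scaleP c x) y = scaleP c (dot x y)"
    for x y z c
    using P.dot_bilinear unfolding bilinear_op_iff by auto
  have pb_lin: "pb x (y + z) = pb x y + pb x z" "pb (x + y) z = pb x z + pb y z"
      "pb x (scaleP c y) = scaleP c (pb x y)" "pb (scaleP c x) y = scaleP c (pb x y)" for x y z c
    using P.br_bilinear unfolding bilinear_op_iff by auto
  have G_dot: "dot x y \<in> G" and G_pb: "pb x y \<in> G" if "x \<in> G" "y \<in> G" for x y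
  proof -
    from that obtain v w where "x = ev v" "y = ev w" unfolding G_def by blast
    then have "dot x y = ev (Mul v w)" "pb x y = ev (Brk v w)" by (simp_all add: ev_def)
    then show "dot x y \<in> G" "pb x y \<in> G" unfolding G_def by blast+
  qed
  have G_d: "d x \<in> G" if "x \<in> G" for x
  proof -
    from that obtain w where "x = ev w" unfolding G_def by blast
    then have "d x = ev (Dif w)" by (simp add: ev_def)
    then show ?thesis unfolding G_def by blast
  qed
  have W_dot: "dot x y \<in> W" if "x \<in> W" "y \<in> W" for x y
    using that unfolding W_def by (intro bilinear_op_span_closed[OF P.dot_bilinear] G_dot)
  have W_pb: "pb x y \<in> W" if "x \<in> W" "y \<in> W" for x y
    using that unfolding W_def by (intro bilinear_op_span_closed[OF P.br_bilinear] G_pb)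
  have d_zero: "d 0 = 0"
    using d_lin(1)[of 0 0] by simp
  have W_d: "d x \<in> W" if "x \<in> W" for x
    using that unfolding W_def
  proof (induction rule: P.span_induct)
    case base
    show ?case unfolding P.subspace_def
      by (auto simp: d_lin d_zero intro: P.span_zero P.span_add P.span_scale)
  next
    case (step x)
    then show ?case by (intro P.span_base G_d)
  qed
  have W_f: "f x \<in> W" for x
    unfolding W_def G_def ev_def by (rule P.span_base) (metis rangeI word_eval.simps(1))

  define dot' where "dot' = (\<lambda>u v. s (dot (E u) (E v)))"
  define pb' where "pb' = (\<lambda>u v. s (pb (E u) (E v)))"
  define d' where "d' = (\<lambda>u. s (d (E u)))"
  define f' where "f' = (\<lambda>x. s (f x))"
  note ops = dot'_def pb'_def d'_def f'_def
  note W_closed = W_dot W_pb W_d W_f E_W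
  note lins = E_add E_scale s_add s_scale d_lin dot_lin pb_lin
  have bil: "bilinear_op word_scale dot'" "bilinear_op word_scale pb'"
    unfolding bilinear_op_iff ops using vector_space_word_scale by (auto simp: lins)
  have jac: "pb' x (pb' y z) + pb' y (pb' z x) + pb' z (pb' x y) = 0" for x y z
    using P.br_jacobi[of "E x" "E y" "E z"]
    by (simp add: ops s W_closed s_zero flip: s_add)
  have d'_lin: "Vector_Spaces.linear word_scale word_scale d'"
    unfolding Vector_Spaces.linear_iff ops using vector_space_word_scale by (simp add: lins)
  have P': "differential_poisson_algebra word_scale pb' dot' d'"
  proof (intro differential_poisson_algebra.intro poisson_algebra.intro lie_algebra.intro
      vector_space_word_scale lie_algebra_axioms.intro poisson_algebra_axioms.intro
      differential_poisson_algebra_axioms.intro bil jac)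
    show "pb' x x = 0" for x by (simp add: ops P.br_self s_zero)
    show "dot' x y = dot' y x" for x y by (simp add: ops P.dot_commute)
    show "dot' (dot' x y) z = dot' x (dot' y z)" for x y z
      by (simp add: ops s W_closed P.dot_assoc)
    show "pb' x (dot' y z) = dot' (pb' x y) z + dot' y (pb' x z)" for x y z
      by (simp add: ops s W_closed P.pb_leibniz flip: s_add)
    show "derivation_of word_scale dot' d'" "derivation_of word_scale pb' d'"
      unfolding derivation_of_def using d'_lin
      by (auto simp: ops s W_closed d_prod simp flip: s_add)
  qed
  have f_lin: "Vector_Spaces.linear scale scaleP f" and f_inj: "inj f"
    and f_hom: "\<And>x y. f (circ x y) = dot (f x) (d (f y))" "\<And>x y. f (br x y) = pb (f x) (f y)"
    using iso unfolding GD_isomorphism_onto_def induced_circ_def bij_betw_def by auto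
  have f'_lin: "Vector_Spaces.linear scale word_scale f'"
    using f_lin vector_space_word_scale unfolding Vector_Spaces.linear_iff
    by (simp add: ops lins)
  have f'_inj: "inj f'"
    using f_inj s W_f unfolding inj_def f'_def by metis
  have f'_hom: "f' (circ x y) = induced_circ dot' d' (f' x) (f' y)"
      "f' (br x y) = pb' (f' x) (f' y)" for x y
    by (simp_all add: induced_circ_def ops s W_closed f_hom)
  interpret GD: GD_algebra scale circ br by fact
  interpret VA: vector_space_pair scale word_scale
    by (intro vector_space_pair.intro vector_space_word_scale GD.vector_space_axioms)
  have "GD_subalgebra word_scale (induced_circ dot' d') pb' (range f')"
    unfolding GD_subalgebra_def
    using VA.linear_subspace_image[OF f'_lin GD.subspace_UNIV] f'_hom by (metis (no_types, lifting) imageE rangeI)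
  moreover have "GD_isomorphism_onto scale circ br word_scale (induced_circ dot' d') pb' (range f') f'"
    unfolding GD_isomorphism_onto_def using f'_lin f'_inj f'_hom by (auto simp: bij_betw_def)
  ultimately show ?thesis
    unfolding special_GD_algebra_def using GD P' by blast
qed

end

theory Submission
  imports Defs "HOL-Library.Multiset"
begin

text \<open>Two commuting derivations \<open>d\<close> and \<open>\<Delta>\<close> of a commutative algebra give the Poisson bracket
\<open>{u, v} = \<Delta>(u) d(v) - \<Delta>(v) d(u)\<close>, of which \<open>d\<close> is again a derivation. If \<open>A\<close> sits in the algebra in
such a way that \<open>x \<circ> y = x d(y)\<close> and \<open>\<Delta>\<close> extends \<open>D\<close>, then this bracket restricts to
\<open>D(x) \<circ> y - D(y) \<circ> x\<close> on \<open>A\<close>. So the theorem amounts to a functorial form of the embedding of a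
Novikov algebra into a commutative differential algebra.

The differential algebra is a quotient of the polynomial ring in the variables \<open>x\<^sup>(\<^sup>n\<^sup>)\<close>, for \<open>x\<close> in \<open>A\<close>
and \<open>n \<ge> 0\<close>, with \<open>d\<close> sending \<open>x\<^sup>(\<^sup>n\<^sup>)\<close> to \<open>x\<^sup>(\<^sup>n\<^sup>+\<^sup>1\<^sup>)\<close> and \<open>\<Delta>\<close> sending it to \<open>(D x)\<^sup>(\<^sup>n\<^sup>)\<close>. The
point is that the relations \<open>x\<^sup>(\<^sup>0\<^sup>) y\<^sup>(\<^sup>1\<^sup>) = (x \<circ> y)\<^sup>(\<^sup>0\<^sup>)\<close> and their derivatives do not identify elements
of \<open>A\<close>. This is shown with a linear map back to \<open>A\<close>, \<open>eval_mpoly\<close>, which gives every monomial of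
weight -1, where \<open>x\<^sup>(\<^sup>n\<^sup>)\<close> has weight \<open>n - 1\<close>, the value that it would have if \<open>A\<close> were embedded, and which
sends \<open>x\<^sup>(\<^sup>0\<^sup>)\<close> to \<open>x\<close>. The ideal divided out is the largest \<open>d\<close>-stable ideal in its kernel,
\<open>eval_ideal\<close>; it meets \<open>A\<close> trivially, and it is \<open>\<Delta>\<close>-stable because the construction is natural.

What the map must do to \<open>x\<^sub>1 \<dots> x\<^sub>n y\<^sup>(\<^sup>n\<^sup>)\<close> is dictated by the Leibniz rule: this is
\<open>x\<^sub>1 d(x\<^sub>2 \<dots> x\<^sub>n y\<^sup>(\<^sup>n\<^sup>-\<^sup>1\<^sup>))\<close> minus the terms in which \<open>d\<close> hits some \<open>x\<^sub>j\<close> and produces \<open>x\<^sub>1 \<circ> x\<^sub>j\<close>. The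
resulting operations \<open>brace\<close> are symmetric in the \<open>x\<^sub>i\<close> because a left symmetric product is pre-Lie (they
are its symmetric braces). A longer monomial is evaluated by absorbing its factors \<open>y\<^sup>(\<^sup>a\<^sup>)\<close>, \<open>a \<ge> 1\<close>, one
after the other, each consuming \<open>a\<close> of the factors without derivative and returning one. The value
does not depend on the choices: this is \<open>braces_commute\<close>, where right commutativity enters. The Leibniz
rule \<open>eval_mpoly_circ\<close>, the evaluation of \<open>z d(p)\<close> being \<open>z\<close> \<open>\<circ>\<close> the evaluation of \<open>p\<close>, then
carries a relation over to all its derivatives (\<open>eval_idealI\<close>).\<close>

section \<open>Symmetric functions of lists\<close>

definition symmetric_at :: "nat \<Rightarrow> ('b list \<Rightarrow> 'v) \<Rightarrow> bool" where
  "symmetric_at n F \<longleftrightarrow> (\<forall>xs ys. length xs = n \<longrightarrow> mset xs = mset ys \<longrightarrow> F xs = F ys)"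

lemma symmetric_atD: "symmetric_at n F \<Longrightarrow> length xs = n \<Longrightarrow> mset xs = mset ys \<Longrightarrow> F xs = F ys"
  unfolding symmetric_at_def by blast

lemma symmetric_at_SucI:
  fixes F :: "'b list \<Rightarrow> 'v"
  assumes tail: "\<And>x. symmetric_at n (\<lambda>us. F (x # us))"
    and swap: "\<And>x y us. Suc (length us) = n \<Longrightarrow> F (x # y # us) = F (y # x # us)"
  shows "symmetric_at (Suc n) F"
  unfolding symmetric_at_def
proof (intro allI impI)
  fix xs ys :: "'b list"
  assume len: "length xs = Suc n" and eq: "mset xs = mset ys"
  have leny: "length ys = Suc n" using len eq by (metis mset_eq_length)
  obtain x us where xs: "xs = x # us" and us: "length us = n" using len by (cases xs) auto
  obtain y vs where ys: "ys = y # vs" and vs: "length vs = n" using leny by (cases ys) auto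
  show "F xs = F ys"
  proof (cases "x = y")
    case True
    then have "mset us = mset vs" using eq by (simp add: xs ys)
    then show ?thesis using symmetric_atD[OF tail us] True by (simp add: xs ys)
  next
    case False
    have "y \<in># mset xs" using eq by (simp add: ys)
    then have "y \<in># mset us" using False by (simp add: xs)
    then obtain ws where uw: "mset us = mset (y # ws)"
      by (metis insert_DiffM mset.simps(2) mset_remove1)
    have "add_mset x (mset us) = add_mset y (mset vs)" using eq by (simp add: xs ys)
    then have vw: "mset vs = mset (x # ws)" unfolding uw by simp
    have l: "Suc (length ws) = n"
      using uw us by (metis length_Cons mset_eq_length)
    have "F xs = F (x # y # ws)" using symmetric_atD[OF tail us uw] by (simp add: xs)
    also have "\<dots> = F (y # x # ws)" by (rule swap[OF l])
    also have "\<dots> = F ys" using symmetric_atD[OF tail vs vw] by (simp add: ys)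
    finally show ?thesis .
  qed
qed

text \<open>Adjacent transpositions generate all permutations; the induction needs only that the transposition
of the first two entries and the permutations of the tail do.\<close>

lemma symmetric_at_adjacentI:
  fixes F :: "'b list \<Rightarrow> 'v"
  assumes "\<And>us x y vs. length us + length vs + 2 = n \<Longrightarrow> F (us @ x # y # vs) = F (us @ y # x # vs)"
  shows "symmetric_at n F"
  using assms
proof (induction n arbitrary: F)
  case 0
  then show ?case by (simp add: symmetric_at_def)
next
  case (Suc n)
  show ?case
  proof (rule symmetric_at_SucI)
    fix x
    show "symmetric_at n (\<lambda>us. F (x # us))"
    proof (rule Suc.IH)
      fix y z and us vs :: "'b list"
      assume "length us + length vs + 2 = n"
      then show "F (x # us @ y # z # vs) = F (x # us @ z # y # vs)"
        using Suc.prems[of "x # us" vs y z] by simp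
    qed
  next
    fix x y and us :: "'b list"
    assume "Suc (length us) = n"
    then show "F (x # y # us) = F (y # x # us)" using Suc.prems[of "[]" us x y] by simp
  qed
qed

section \<open>Sums over the positions of a list\<close>

text \<open>Both \<open>d\<close> and \<open>\<Delta>\<close> act on a product by acting on one factor at a time, so their effect on a
function of a list of factors is this sum.\<close>

definition slot_sum :: "('b \<Rightarrow> 'b) \<Rightarrow> ('b list \<Rightarrow> 'v::comm_monoid_add) \<Rightarrow> 'b list \<Rightarrow> 'v" where
  "slot_sum \<delta> F xs = (\<Sum>i<length xs. F (xs[i := \<delta> (xs ! i)]))"

lemma slot_sum_Nil [simp]: "slot_sum \<delta> F [] = 0"
  by (simp add: slot_sum_def)

lemma slot_sum_Cons [simp]:
  "slot_sum \<delta> F (x # xs) = F (\<delta> x # xs) + slot_sum \<delta> (\<lambda>us. F (x # us)) xs"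
  by (simp add: slot_sum_def sum.lessThan_Suc_shift del: sum.lessThan_Suc)

lemma slot_sum_append:
  "slot_sum \<delta> F (xs @ ys) = slot_sum \<delta> (\<lambda>us. F (us @ ys)) xs + slot_sum \<delta> (\<lambda>vs. F (xs @ vs)) ys"
  by (induction xs arbitrary: F) (simp_all add: add.assoc)

lemma slot_sum_cong:
  assumes "\<And>us. length us = length xs \<Longrightarrow> F us = G us"
  shows "slot_sum \<delta> F xs = slot_sum \<delta> G xs"
  using assms by (simp add: slot_sum_def)

lemma slot_sum_cong_nth:
  assumes "\<And>i. i < length xs \<Longrightarrow> F (xs[i := \<delta> (xs ! i)]) = G (xs[i := \<delta> (xs ! i)])"
  shows "slot_sum \<delta> F xs = slot_sum \<delta> G xs"
  using assms by (simp add: slot_sum_def)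

lemma slot_sum_add:
  "slot_sum \<delta> (\<lambda>us. F us + G us) xs = slot_sum \<delta> F xs + slot_sum \<delta> G xs"
  by (simp add: slot_sum_def sum.distrib)

lemma slot_sum_diff:
  fixes F G :: "'b list \<Rightarrow> 'v::ab_group_add"
  shows "slot_sum \<delta> (\<lambda>us. F us - G us) xs = slot_sum \<delta> F xs - slot_sum \<delta> G xs"
  by (simp add: slot_sum_def sum_subtractf)

lemma slot_sum_additive:
  fixes h :: "'v::ab_group_add \<Rightarrow> 'w::ab_group_add"
  assumes "\<And>x y. h (x + y) = h x + h y"
  shows "h (slot_sum \<delta> F xs) = slot_sum \<delta> (\<lambda>us. h (F us)) xs"
proof -
  have "h 0 = 0" using assms[of 0 0] by simp
  then show ?thesis by (induction xs arbitrary: F) (simp_all add: assms)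
qed

text \<open>The terms in which \<open>\<delta>\<close> and \<open>\<epsilon>\<close> act at different positions cancel, and those at a common position
remain.\<close>

lemma slot_sum_commutator:
  fixes F :: "'b list \<Rightarrow> 'v::ab_group_add"
  shows "slot_sum \<delta> (slot_sum \<epsilon> F) xs - slot_sum \<epsilon> (slot_sum \<delta> F) xs =
    slot_sum (\<lambda>x. \<epsilon> (\<delta> x)) F xs - slot_sum (\<lambda>x. \<delta> (\<epsilon> x)) F xs"
proof (induction xs arbitrary: F)
  case (Cons x xs)
  show ?case using Cons.IH[of "\<lambda>us. F (x # us)"]
    by (simp add: slot_sum_add algebra_simps)
qed simp

lemma symmetric_at_slot_sum:
  fixes F :: "'b list \<Rightarrow> 'v::comm_monoid_add"
  assumes "symmetric_at n F"
  shows "symmetric_at n (slot_sum \<delta> F)"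
  using assms
proof (induction n arbitrary: F)
  case 0
  then show ?case by (simp add: symmetric_at_def)
next
  case (Suc n)
  have tail: "symmetric_at n (\<lambda>us. F (x # us))" for x
    using Suc.prems by (simp add: symmetric_at_def)
  show ?case
  proof (rule symmetric_at_SucI)
    fix x
    have "symmetric_at n (\<lambda>us. F (\<delta> x # us))" by (rule tail)
    moreover have "symmetric_at n (slot_sum \<delta> (\<lambda>us. F (x # us)))" by (rule Suc.IH[OF tail])
    ultimately show "symmetric_at n (\<lambda>us. slot_sum \<delta> F (x # us))"
      unfolding symmetric_at_def slot_sum_Cons by metis
  next
    fix x y and us :: "'b list"
    assume l: "Suc (length us) = n"
    have sw: "F (a # b # vs) = F (b # a # vs)" if "length vs = length us" for a b vs
      using symmetric_atD[OF Suc.prems, of "a # b # vs" "b # a # vs"] that l by simp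
    have "slot_sum \<delta> (\<lambda>us. F (x # y # us)) us = slot_sum \<delta> (\<lambda>us. F (y # x # us)) us"
      by (intro slot_sum_cong sw)
    then show "slot_sum \<delta> F (x # y # us) = slot_sum \<delta> F (y # x # us)"
      by (simp add: sw add_ac)
  qed
qed

section \<open>Symmetric braces of a Novikov algebra\<close>

text \<open>The pair \<open>(x, n)\<close> stands for the variable \<open>x\<^sup>(\<^sup>n\<^sup>)\<close>, the \<open>n\<close>-th derivative of \<open>x\<close>.\<close>

definition raise :: "'v \<times> nat \<Rightarrow> 'v \<times> nat" where
  "raise v = (fst v, Suc (snd v))"

context novikov_algebra
begin

abbreviation lin :: "('a \<Rightarrow> 'a) \<Rightarrow> bool" where
  "lin \<equiv> Vector_Spaces.linear scale scale"

lemma lin_iff: "lin h \<longleftrightarrow> (\<forall>x y. h (x + y) = h x + h y) \<and> (\<forall>c x. h (scale c x) = scale c (h x))"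
  unfolding Vector_Spaces.linear_iff using vector_space_axioms by simp

lemma lin_add: "lin h \<Longrightarrow> h (x + y) = h x + h y"
  and lin_scale: "lin h \<Longrightarrow> h (scale c x) = scale c (h x)"
  by (simp_all add: lin_iff)

lemma lin_diff: "lin h \<Longrightarrow> h (x - y) = h x - h y"
  using lin_add[of h "x - y" y] by simp

lemma lin_zero: "lin h \<Longrightarrow> h 0 = 0"
  using lin_add[of h 0 0] by simp

lemma lin_comp: "lin h \<Longrightarrow> lin g \<Longrightarrow> lin (\<lambda>x. h (g x))"
  by (simp add: lin_iff)

lemma lin_plus: "lin h \<Longrightarrow> lin g \<Longrightarrow> lin (\<lambda>x. h x + g x)"
  by (simp add: lin_iff scale_right_distrib)

lemma lin_minus: "lin h \<Longrightarrow> lin g \<Longrightarrow> lin (\<lambda>x. h x - g x)"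
  by (simp add: lin_iff scale_right_diff_distrib)

lemma lin_slot_sum:
  assumes "\<And>us. length us = length xs \<Longrightarrow> lin (\<lambda>x. G x us)"
  shows "lin (\<lambda>x. slot_sum \<delta> (G x) xs)"
  using assms
proof (induction xs arbitrary: G)
  case Nil
  show ?case by (simp add: lin_iff)
next
  case (Cons a xs)
  show ?case unfolding slot_sum_Cons by (intro lin_plus Cons.IH Cons.prems) simp_all
qed

lemma circ_lin_right: "lin (circ x)" and circ_lin_left: "lin (\<lambda>x. circ x y)"
  using circ_bilinear by (simp_all add: bilinear_op_def)

lemma circ_simps:
  "circ x (y + z) = circ x y + circ x z" "circ (x + y) z = circ x z + circ y z"
  "circ x (y - z) = circ x y - circ x z" "circ (x - y) z = circ x z - circ y z"
  using lin_add[OF circ_lin_right] lin_add[OF circ_lin_left]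
    lin_diff[OF circ_lin_right] lin_diff[OF circ_lin_left] by simp_all

lemma circ_slot_sum: "circ x (slot_sum \<delta> F us) = slot_sum \<delta> (\<lambda>us. circ x (F us)) us"
  by (rule slot_sum_additive) (rule circ_simps)

definition multilinear_at :: "nat \<Rightarrow> ('a list \<Rightarrow> 'a) \<Rightarrow> bool" where
  "multilinear_at n F \<longleftrightarrow>
     (\<forall>us vs. Suc (length us + length vs) = n \<longrightarrow> lin (\<lambda>x. F (us @ x # vs)))"

lemma multilinear_atD: "multilinear_at n F \<Longrightarrow> Suc (length us + length vs) = n \<Longrightarrow> lin (\<lambda>x. F (us @ x # vs))"
  unfolding multilinear_at_def by blast

lemma multilinear_at_hd: "multilinear_at (Suc n) F \<Longrightarrow> length vs = n \<Longrightarrow> lin (\<lambda>x. F (x # vs))"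
  using multilinear_atD[of "Suc n" F "[]" vs] by simp

lemma multilinear_at_tl: "multilinear_at (Suc n) F \<Longrightarrow> multilinear_at n (\<lambda>us. F (x # us))"
  unfolding multilinear_at_def[of n]
proof (intro allI impI)
  fix us vs :: "'a list"
  assume "multilinear_at (Suc n) F" "Suc (length us + length vs) = n"
  then show "lin (\<lambda>y. F (x # us @ y # vs))"
    using multilinear_atD[of "Suc n" F "x # us" vs] by simp
qed

lemma slot_sum_diff_slots:
  assumes "multilinear_at n F" "length xs = n"
  shows "slot_sum (\<lambda>x. \<delta> x - \<epsilon> x) F xs = slot_sum \<delta> F xs - slot_sum \<epsilon> F xs"
  using assms
proof (induction xs arbitrary: n F)
  case (Cons x xs)
  obtain n' where n: "n = Suc n'" "length xs = n'" using Cons.prems by auto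
  have "lin (\<lambda>x. F (x # xs))" using multilinear_at_hd Cons.prems(1) n by blast
  from lin_diff[OF this] show ?case
    using Cons.IH[OF multilinear_at_tl[of n' F x]] Cons.prems(1) n by simp
qed simp

lemma multilinear_at_slot_sum:
  assumes F: "multilinear_at n F" and \<delta>: "lin \<delta>"
  shows "multilinear_at n (slot_sum \<delta> F)"
  unfolding multilinear_at_def
proof (intro allI impI)
  fix us vs :: "'a list"
  assume l: "Suc (length us + length vs) = n"
  show "lin (\<lambda>x. slot_sum \<delta> F (us @ x # vs))"
    unfolding slot_sum_append slot_sum_Cons
  proof (intro lin_plus lin_slot_sum)
    show "lin (\<lambda>x. F (ws @ x # vs))" if "length ws = length us" for ws
      using multilinear_atD[OF F] l that by simp
    show "lin (\<lambda>x. F (us @ \<delta> x # vs))"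
      using lin_comp[OF multilinear_atD[OF F l] \<delta>] .
    show "lin (\<lambda>x. F (us @ x # ws))" if "length ws = length vs" for ws
      using multilinear_atD[OF F] l that by simp
  qed
qed

text \<open>If \<open>f us\<close> is the value of a product of \<open>us\<close> with a differential expression \<open>p\<close>, then
\<open>extend_op f (x # us)\<close> is the value of the product of \<open>x\<close>, \<open>us\<close> and \<open>d p\<close>, by
the Leibniz rule and \<open>x d(u) = x \<circ> u\<close>. The value on the empty list is a default.\<close>

definition extend_op :: "('a list \<Rightarrow> 'a) \<Rightarrow> 'a list \<Rightarrow> 'a" where
  "extend_op f xs = (case xs of [] \<Rightarrow> 0 | x # us \<Rightarrow> circ x (f us) - slot_sum (circ x) f us)"

lemma extend_op_Cons: "extend_op f (x # us) = circ x (f us) - slot_sum (circ x) f us"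
  by (simp add: extend_op_def)

text \<open>\<open>brace n y [x\<^sub>1, \<dots>, x\<^sub>n]\<close> is the value of \<open>x\<^sub>1 \<dots> x\<^sub>n y\<^sup>(\<^sup>n\<^sup>)\<close>. Its argument lists have length \<open>n\<close>.\<close>

primrec brace :: "nat \<Rightarrow> 'a \<Rightarrow> 'a list \<Rightarrow> 'a" where
  "brace 0 y = (\<lambda>us. y)"
| "brace (Suc n) y = extend_op (brace n y)"

lemma multilinear_at_extend_op:
  assumes F: "multilinear_at n F"
  shows "multilinear_at (Suc n) (extend_op F)"
  unfolding multilinear_at_def
proof (intro allI impI)
  fix us vs :: "'a list"
  assume l: "Suc (length us + length vs) = Suc n"
  show "lin (\<lambda>x. extend_op F (us @ x # vs))"
  proof (cases us)
    case Nil
    have G: "lin (\<lambda>x. slot_sum (circ x) F ws)" if "multilinear_at m F" "length ws = m" for m F and ws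
      using that
    proof (induction ws arbitrary: m F)
      case Nil
      show ?case by (simp add: lin_iff)
    next
      case (Cons w ws)
      then obtain m' where m: "m = Suc m'" "length ws = m'" by auto
      have F': "multilinear_at (Suc m') F" using Cons.prems m by simp
      show ?case unfolding slot_sum_Cons
        by (intro lin_plus lin_comp[OF multilinear_at_hd[OF F' m(2)] circ_lin_left]
            Cons.IH[OF multilinear_at_tl[OF F'] m(2)])
    qed
    show ?thesis using G[OF F, of vs] l Nil
      by (auto simp: extend_op_Cons intro!: lin_minus circ_lin_left)
  next
    case (Cons u ws)
    have "Suc (length ws + length vs) = n" using l Cons by simp
    from multilinear_atD[OF F this] multilinear_atD[OF multilinear_at_slot_sum[OF F circ_lin_right] this]
    show ?thesis using Cons
      by (auto simp: extend_op_Cons intro!: lin_minus lin_comp[OF circ_lin_right])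
  qed
qed

lemma multilinear_at_brace: "multilinear_at n (brace n y)"
  by (induction n) (simp_all add: multilinear_at_extend_op, simp add: multilinear_at_def)

text \<open>In differential terms, \<open>a b d\<^sup>2\<close> is symmetric in \<open>a\<close> and \<open>b\<close>. The commutator of the substitutions
\<open>u \<mapsto> a \<circ> u\<close> and \<open>u \<mapsto> b \<circ> u\<close> is, by left symmetry, the substitution by the commutator of \<open>a\<close>
and \<open>b\<close>, and left symmetry at \<open>F us\<close> cancels what is left.\<close>

lemma extend_op_twice_swap:
  assumes F: "multilinear_at n F" and us: "length us = n"
  shows "extend_op (extend_op F) (a # b # us) = extend_op (extend_op F) (b # a # us)"
proof -
  define L where "L x = slot_sum (circ x) F us" for x
  define LL where "LL x y = slot_sum (circ x) (slot_sum (circ y) F) us" for x y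
  have e: "extend_op (extend_op F) (x # y # us) =
      circ x (circ y (F us)) - circ x (L y) - (circ (circ x y) (F us) - L (circ x y))
      - (circ y (L x) - LL x y)" for x y
    by (simp add: extend_op_Cons circ_simps slot_sum_diff L_def LL_def circ_slot_sum)
  have "LL a b - LL b a =
      slot_sum (\<lambda>u. circ b (circ a u)) F us - slot_sum (\<lambda>u. circ a (circ b u)) F us"
    unfolding LL_def by (rule slot_sum_commutator)
  also have "\<dots> = slot_sum (\<lambda>u. circ b (circ a u) - circ a (circ b u)) F us"
    by (rule slot_sum_diff_slots[symmetric, OF F us])
  also have "(\<lambda>u. circ b (circ a u) - circ a (circ b u)) =
      (\<lambda>u. circ (circ b a) u - circ (circ a b) u)"
  proof
    fix u
    show "circ b (circ a u) - circ a (circ b u) = circ (circ b a) u - circ (circ a b) u"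
      using circ_left_symmetric[of a b u] by (simp add: algebra_simps)
  qed
  also have "slot_sum (\<lambda>u. circ (circ b a) u - circ (circ a b) u) F us = L (circ b a) - L (circ a b)"
    unfolding L_def by (rule slot_sum_diff_slots[OF F us])
  finally show ?thesis
    unfolding e using circ_left_symmetric[of a b "F us"] by (simp add: algebra_simps)
qed

lemma symmetric_at_brace: "symmetric_at n (brace n y)"
proof (induction n)
  case 0
  show ?case by (simp add: symmetric_at_def)
next
  case (Suc n)
  show ?case
  proof (rule symmetric_at_SucI)
    fix x
    show "symmetric_at n (\<lambda>us. brace (Suc n) y (x # us))"
      unfolding brace.simps extend_op_Cons
      using Suc.IH symmetric_at_slot_sum[OF Suc.IH, of "circ x"]
      unfolding symmetric_at_def by metis
  next
    fix a b and us :: "'a list"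
    assume "Suc (length us) = n"
    then show "brace (Suc n) y (a # b # us) = brace (Suc n) y (b # a # us)"
      using extend_op_twice_swap[OF multilinear_at_brace] by auto
  qed
qed

lemma brace_mset_cong: "length us = n \<Longrightarrow> mset us = mset vs \<Longrightarrow> brace n y us = brace n y vs"
  using symmetric_at_brace by (rule symmetric_atD)

text \<open>In differential terms \<open>z \<circ> w = z w'\<close>, and the scalar \<open>w'\<close> can be taken out of a product. For one
argument this is right commutativity; the inductive step moves \<open>w\<close> past \<open>x\<close> with left symmetry, and
the extra terms cancel.\<close>

lemma brace_circ_right:
  assumes "length us = n"
  shows "brace (Suc n) y (circ z w # us) = circ (brace (Suc n) y (z # us)) w"
  using assms
proof (induction n arbitrary: z w us)
  case 0
  then show ?case using circ_right_commutative by (simp add: extend_op_Cons)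
next
  case (Suc n)
  then obtain x vs where us: "us = x # vs" and vs: "length vs = n" by (cases us) auto
  define B where "B = brace (Suc n) y"
  have IH: "B (circ z w # ws) = circ (B (z # ws)) w" if "length ws = n" for z w ws
    unfolding B_def using Suc.IH that by blast
  have add: "B ((p - q + r) # vs) = B (p # vs) - B (q # vs) + B (r # vs)" for p q r
  proof -
    have l: "lin (\<lambda>p. B (p # vs))"
      unfolding B_def using multilinear_at_hd[OF multilinear_at_brace vs] .
    show ?thesis using lin_add[OF l] lin_diff[OF l] by simp
  qed
  have rest: "slot_sum (circ x) (\<lambda>us. B (circ z w # us)) vs =
      circ (slot_sum (circ x) (\<lambda>us. B (z # us)) vs) w"
  proof -
    have "slot_sum (circ x) (\<lambda>us. B (circ z w # us)) vs =
        slot_sum (circ x) (\<lambda>us. circ (B (z # us)) w) vs"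
      using vs by (intro slot_sum_cong IH) simp
    also have "\<dots> = circ (slot_sum (circ x) (\<lambda>us. B (z # us)) vs) w"
      by (rule slot_sum_additive[symmetric]) (simp add: circ_simps)
    finally show ?thesis .
  qed
  have left: "circ x (circ p w) = circ (circ x p) w - circ (circ p x) w + circ p (circ x w)" for p
    using circ_left_symmetric[of x p w] by (simp add: algebra_simps)
  have front: "brace (Suc (Suc n)) y (u # us) = brace (Suc (Suc n)) y (x # u # vs)" for u
    by (rule brace_mset_cong) (simp_all add: us vs)
  have e: "brace (Suc (Suc n)) y (x # u # vs) =
      circ x (B (u # vs)) - (B (circ x u # vs) + slot_sum (circ x) (\<lambda>us. B (u # us)) vs)" for u
    by (simp add: extend_op_Cons B_def del: brace.simps add: brace.simps(2)[of "Suc n"])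
  have "brace (Suc (Suc n)) y (circ z w # us) =
      circ x (circ (B (z # vs)) w) - (B (circ x (circ z w) # vs)
        + circ (slot_sum (circ x) (\<lambda>us. B (z # us)) vs) w)"
    by (simp only: front e IH[OF vs] rest)
  also have "\<dots> = circ (brace (Suc (Suc n)) y (z # us)) w"
    unfolding front e left[of z] add IH[OF vs] left[of "B (z # vs)"]
    by (simp add: circ_simps algebra_simps)
  finally show ?case .
qed

text \<open>Both sides evaluate the product of \<open>y\<^sup>(\<^sup>a\<^sup>)\<close>, \<open>w\<^sup>(\<^sup>b\<^sup>)\<close> and \<open>a + b - 1\<close> elements of \<open>A\<close>, absorbing either
\<open>y\<^sup>(\<^sup>a\<^sup>)\<close> or \<open>w\<^sup>(\<^sup>b\<^sup>)\<close> first. Letting the two distributions of the arguments vary independently makes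
the property include the symmetry of each side in all the arguments.\<close>

definition braces_commute :: "nat \<Rightarrow> 'a \<Rightarrow> nat \<Rightarrow> 'a \<Rightarrow> bool" where
  "braces_commute a y b w \<longleftrightarrow>
     (\<forall>us vs us' vs'. length us = a \<longrightarrow> Suc (length vs) = b \<longrightarrow> length us' = b \<longrightarrow>
        Suc (length vs') = a \<longrightarrow> mset (us @ vs) = mset (us' @ vs') \<longrightarrow>
        brace b w (brace a y us # vs) = brace a y (brace b w us' # vs'))"

lemma braces_commuteD:
  assumes "braces_commute a y b w" "length us = a" "Suc (length vs) = b" "length us' = b"
    "Suc (length vs') = a" "mset (us @ vs) = mset (us' @ vs')"
  shows "brace b w (brace a y us # vs) = brace a y (brace b w us' # vs')"
  using assms unfolding braces_commute_def by blast

lemma braces_commute_one: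
  assumes "1 \<le> a"
  shows "braces_commute a y 1 w"
  unfolding braces_commute_def
proof (intro allI impI)
  fix us vs us' vs' :: "'a list"
  assume l: "length us = a" "Suc (length vs) = 1" "length us' = 1" "Suc (length vs') = a"
    and m: "mset (us @ vs) = mset (us' @ vs')"
  obtain u where us': "us' = [u]" using l(3) by (cases us') auto
  have "brace 1 w (brace a y us # vs) = circ (brace a y us) w"
    using l(2) by (simp add: extend_op_Cons)
  also have "\<dots> = circ (brace a y (u # vs')) w"
    by (rule arg_cong[where f = "\<lambda>p. circ p w"], rule brace_mset_cong) (use l m us' in auto)
  also have "circ (brace a y (u # vs')) w = brace a y (circ u w # vs')"
    using brace_circ_right[of vs' "length vs'"] l(4) by auto
  also have "\<dots> = brace a y (brace 1 w us' # vs')"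
    by (simp add: us' extend_op_Cons)
  finally show "brace 1 w (brace a y us # vs) = brace a y (brace 1 w us' # vs')" .
qed

text \<open>This is \<open>d(w\<^sup>(\<^sup>b\<^sup>+\<^sup>1\<^sup>) y\<^sup>(\<^sup>a\<^sup>)) = w\<^sup>(\<^sup>b\<^sup>+\<^sup>2\<^sup>) y\<^sup>(\<^sup>a\<^sup>) + w\<^sup>(\<^sup>b\<^sup>+\<^sup>1\<^sup>) y\<^sup>(\<^sup>a\<^sup>+\<^sup>1\<^sup>)\<close>, multiplied by \<open>x\<close>, \<open>us\<close> and \<open>vs\<close>: the
terms in which \<open>x\<close> acts on the inner brace occur twice, with opposite signs.\<close>

lemma brace_leibniz:
  assumes us: "length us = a" and vs: "length vs = b"
  shows "brace (Suc (Suc b)) w (brace a y us # x # vs) + brace (Suc b) w (brace (Suc a) y (x # us) # vs) =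
    extend_op (\<lambda>zs. brace (Suc b) w (brace a y (take a zs) # drop a zs)) (x # us @ vs)"
proof -
  define f where "f = brace (Suc b) w"
  define g where "g = brace a y"
  have lf: "lin (\<lambda>p. f (p # vs))"
    unfolding f_def using multilinear_at_hd[OF multilinear_at_brace vs] .
  have "brace (Suc (Suc b)) w (g us # x # vs) = brace (Suc (Suc b)) w (x # g us # vs)"
    by (rule brace_mset_cong) (simp_all add: vs)
  also have "\<dots> = circ x (f (g us # vs)) - (f (circ x (g us) # vs)
      + slot_sum (circ x) (\<lambda>vs. f (g us # vs)) vs)"
    by (simp add: extend_op_Cons f_def del: brace.simps add: brace.simps(2)[of "Suc b"])
  finally have 1: "brace (Suc (Suc b)) w (g us # x # vs) = \<dots>" .
  have "f (brace (Suc a) y (x # us) # vs) = f ((circ x (g us) - slot_sum (circ x) g us) # vs)"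
    by (simp add: extend_op_Cons g_def)
  also have "\<dots> = f (circ x (g us) # vs) - f (slot_sum (circ x) g us # vs)"
    using lin_diff[OF lf] .
  also have "f (slot_sum (circ x) g us # vs) = slot_sum (circ x) (\<lambda>us. f (g us # vs)) us"
    using slot_sum_additive[OF lin_add[OF lf]] .
  finally have 2: "f (brace (Suc a) y (x # us) # vs) =
      f (circ x (g us) # vs) - slot_sum (circ x) (\<lambda>us. f (g us # vs)) us" .
  have 3: "slot_sum (circ x) (\<lambda>zs. f (g (take a zs) # drop a zs)) (us @ vs) =
      slot_sum (circ x) (\<lambda>us. f (g us # vs)) us + slot_sum (circ x) (\<lambda>vs. f (g us # vs)) vs"
    unfolding slot_sum_append
    by (intro arg_cong2[where f = "(+)"] slot_sum_cong) (simp_all add: us)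
  show ?thesis
    using 1 2 3 us by (simp add: extend_op_Cons f_def g_def del: brace.simps)
qed

text \<open>Expand the derivative of \<open>w\<^sup>(\<^sup>b\<^sup>) y\<^sup>(\<^sup>a\<^sup>)\<close> by the Leibniz rule, once with either order of absorption.
By the hypothesis for \<open>(a, b)\<close> the two derivatives agree, and by the one for \<open>(a + 1, b)\<close> so do the
terms \<open>w\<^sup>(\<^sup>b\<^sup>) y\<^sup>(\<^sup>a\<^sup>+\<^sup>1\<^sup>)\<close>; hence the remaining terms \<open>w\<^sup>(\<^sup>b\<^sup>+\<^sup>1\<^sup>) y\<^sup>(\<^sup>a\<^sup>)\<close> agree.\<close>

lemma braces_commute_Suc:
  assumes ab: "braces_commute a y b w" and ab': "braces_commute (Suc a) y b w"
    and a: "1 \<le> a" and b: "1 \<le> b"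
  shows "braces_commute a y (Suc b) w"
proof -
  define a0 b0 where "a0 = a - 1" and "b0 = b - 1"
  have a0: "a = Suc a0" and b0: "b = Suc b0" using a b by (simp_all add: a0_def b0_def)
  define f where "f = brace b w"
  define g where "g = brace a y"
  define f' where "f' = brace (Suc b) w"
  define g' where "g' = brace (Suc a) y"
  define h where "h zs = f (g (take a zs) # drop a zs)" for zs
  define h' where "h' zs = g (f (take b zs) # drop b zs)" for zs
  define n where "n = a + b0"
  have hh': "h us = h' vs" if "length us = n" "mset us = mset vs" for us vs
    unfolding h_def h'_def f_def g_def
    by (rule braces_commuteD[OF ab]) (use that mset_eq_length[OF that(2)] in \<open>auto simp: n_def a0 b0\<close>)
  have sym: "symmetric_at n h"
    unfolding symmetric_at_def
  proof (intro allI impI)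
    fix xs ys :: "'a list"
    assume "length xs = n" "mset xs = mset ys"
    then have "h xs = h' ys" "h ys = h' ys" using hh' mset_eq_length by metis+
    then show "h xs = h ys" by simp
  qed
  have ext: "extend_op h (x # us) = extend_op h' (x # vs)"
    if "length us = n" "mset us = mset vs" for x us vs
  proof -
    have lv: "length vs = n" using that mset_eq_length by metis
    have "slot_sum (circ x) h us = slot_sum (circ x) h vs"
      using symmetric_at_slot_sum[OF sym] that by (rule symmetric_atD)
    also have "\<dots> = slot_sum (circ x) h' vs"
      using lv by (intro slot_sum_cong hh') simp_all
    finally show ?thesis using hh'[OF that] by (simp add: extend_op_Cons)
  qed
  (* The Leibniz rule singles out one argument x, which lies next to w on both sides. *)
  have same: "f' (g us # x # vs) = g (f' (x # us') # vs')"
    if l: "length us = a" "length vs = b0" "length us' = b" "length vs' = a0"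
      and m: "mset (us @ vs) = mset (us' @ vs')" for x us vs us' vs'
  proof -
    have 1: "f' (g us # x # vs) + f (g' (x # us) # vs) = extend_op h (x # us @ vs)"
      using brace_leibniz[of us a vs b0 w y x] l
      by (simp add: f_def g_def f'_def g'_def h_def[abs_def] b0 del: brace.simps)
    have 2: "g' (f us' # x # vs') + g (f' (x # us') # vs') = extend_op h' (x # us' @ vs')"
      using brace_leibniz[of us' b vs' a0 y w x] l
      by (simp add: f_def g_def f'_def g'_def h'_def[abs_def] a0 del: brace.simps)
    have 3: "f (g' (x # us) # vs) = g' (f us' # x # vs')"
      unfolding f_def g'_def
      by (rule braces_commuteD[OF ab']) (use l m in \<open>auto simp: a0 b0\<close>)
    have "extend_op h (x # us @ vs) = extend_op h' (x # us' @ vs')"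
      using l m by (intro ext) (auto simp: n_def)
    then show ?thesis using 1 2 3 by (metis add.commute add_left_cancel)
  qed
  show ?thesis
    unfolding braces_commute_def
  proof (intro allI impI)
    fix us vs us' vs' :: "'a list"
    assume l: "length us = a" "Suc (length vs) = Suc b" "length us' = Suc b" "Suc (length vs') = a"
      and m: "mset (us @ vs) = mset (us' @ vs')"
    obtain x vs0 where vs: "vs = x # vs0" "length vs0 = b0" using l(2) b0 by (cases vs) auto
    obtain t us0 where us': "us' = t # us0" "length us0 = b" using l(3) by (cases us') auto
    have "f' (g us # vs) = g (f' us' # vs')"
    (* If the arguments x and t next to w differ, pass through a distribution where both are next to w
       on the right-hand side, and exchange them by the symmetry of f'. *)
    proof (cases "x = t")
      case True
      show ?thesis unfolding vs(1) us'(1) True by (rule same) (use True l m vs us' a0 in auto)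
    next
      case False
      have "t \<in># mset (us @ vs)" using m us' by simp
      then have t: "t \<in> set (us @ vs0)" using False vs by auto
      define ws where "ws = remove1 t (us @ vs0)"
      have ws: "mset (us @ vs0) = mset (t # ws)"
        using t unfolding ws_def by (metis insert_DiffM mset.simps(2) mset_remove1 set_mset_mset)
      then have lws: "length ws = b0 + a0"
        using l(1) vs(2) a0 by (metis add_Suc add_right_cancel add.commute length_Cons length_append mset_eq_length nat.inject)
      define us1 where "us1 = take b0 ws"
      define vs1 where "vs1 = drop b0 ws"
      have l1: "length us1 = b0" "length vs1 = a0" "ws = us1 @ vs1"
        using lws by (simp_all add: us1_def vs1_def)
      have m1: "mset (us0 @ vs') = mset (x # ws)"
        using m ws vs us' by (metis (no_types, lifting) add_mset_add_mset_same_iff add_mset_commute append_Cons mset.simps(2) mset_append union_mset_add_mset_right)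
      define us2 where "us2 = take a0 ws"
      define vs2 where "vs2 = drop a0 ws"
      have l2: "length us2 = a0" "length vs2 = b0" "ws = us2 @ vs2"
        using lws by (simp_all add: us2_def vs2_def)
      have m2: "mset us2 + mset vs2 = mset us1 + mset vs1"
        using l1(3) l2(3) by (metis mset_append)
      have "f' (g us # vs) = g (f' (x # t # us1) # vs1)"
        unfolding vs by (rule same) (use l vs ws l1 b0 in auto)
      also have "f' (x # t # us1) = f' (t # x # us1)"
        unfolding f'_def by (rule brace_mset_cong) (use l1 b0 in auto)
      also have "g (f' (t # x # us1) # vs1) = f' (g (x # us2) # t # vs2)"
        by (rule same[symmetric]) (use l1(1,2) l2(1,2) m2 a0 b0 in auto)
      also have "\<dots> = g (f' (t # us0) # vs')"
        by (rule same) (use l2 l us' m1 a0 b0 in auto)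
      finally show ?thesis by (simp add: us')
    qed
    then show "brace (Suc b) w (brace a y us # vs) = brace a y (brace (Suc b) w us' # vs')"
      by (simp add: f'_def g_def)
  qed
qed

lemma braces_commute:
  assumes "1 \<le> a" "1 \<le> b"
  shows "braces_commute a y b w"
  using assms(2,1)
proof (induction b arbitrary: a rule: dec_induct)
  case base
  then show ?case by (rule braces_commute_one)
next
  case (step b)
  then show ?case by (intro braces_commute_Suc) auto
qed

text \<open>Both sides equal the same product with \<open>w\<close> absorbed before \<open>y\<close>.\<close>

lemma braces_exchange:
  assumes "1 \<le> a" "1 \<le> b" "length us = a" "Suc (length vs) = b" "length us' = a" "Suc (length vs') = b"
    and m: "mset (us @ vs) = mset (us' @ vs')"
  shows "brace b w (brace a y us # vs) = brace b w (brace a y us' # vs')"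
proof -
  define ws where "ws = us @ vs"
  have ws: "mset (us @ vs) = mset (take b ws @ drop b ws)" "mset (us' @ vs') = mset (take b ws @ drop b ws)"
    using m by (simp_all only: ws_def append_take_drop_id)
  have l: "length (take b ws) = b" "Suc (length (drop b ws)) = a"
    using assms by (auto simp: ws_def)
  show ?thesis
    using braces_commuteD[OF braces_commute[OF assms(1,2)] assms(3,4) l ws(1), of w y]
      braces_commuteD[OF braces_commute[OF assms(1,2)] assms(5,6) l ws(2), of w y] by simp
qed

section \<open>Evaluation of products of derivatives\<close>

text \<open>The value of the product of the derivatives in the first list and the elements of \<open>A\<close> in the second
list, which serves as a stack: \<open>y\<^sup>(\<^sup>a\<^sup>)\<close> removes the first \<open>a\<close> entries and pushes their brace.\<close>

primrec eval_word :: "('a \<times> nat) list \<Rightarrow> 'a list \<Rightarrow> 'a" where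
  "eval_word [] zs = hd zs"
| "eval_word (v # ys) zs = eval_word ys (brace (snd v) (fst v) (take (snd v) zs) # drop (snd v) zs)"

text \<open>A product of \<open>n\<close> elements of \<open>A\<close> and the derivatives \<open>ys\<close> has weight -1 and all orders in \<open>ys\<close> are
positive. Then the stack never runs short, whatever the order of \<open>ys\<close>, and exactly one entry is left.\<close>

definition balanced :: "('a \<times> nat) list \<Rightarrow> nat \<Rightarrow> bool" where
  "balanced ys n \<longleftrightarrow> (\<forall>v\<in>set ys. 1 \<le> snd v) \<and> n + length ys = Suc (sum_list (map snd ys))"

lemma length_le_sum_list_snd:
  "\<forall>v\<in>set ys. 1 \<le> snd v \<Longrightarrow> length ys \<le> sum_list (map snd ys)"
  by (induction ys) auto

lemma balanced_ConsD:
  assumes "balanced (v # ys) n"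
  shows "1 \<le> snd v" "snd v \<le> n" "balanced ys (Suc (n - snd v))"
  using assms length_le_sum_list_snd[of ys] by (auto simp: balanced_def)

lemma balanced_mset_cong:
  assumes "mset ys = mset ys'"
  shows "balanced ys n = balanced ys' n"
proof -
  have "sum_list (map snd ys) = sum_list (map snd ys')"
    using assms by (metis mset_map sum_mset_sum_list)
  then show ?thesis
    using assms mset_eq_setD[OF assms] mset_eq_length[OF assms] by (simp add: balanced_def)
qed

lemma eval_word_adjacent_swap:
  assumes "balanced (us @ v # w # ys) (length zs)"
  shows "eval_word (us @ v # w # ys) zs = eval_word (us @ w # v # ys) zs"
  using assms
proof (induction us arbitrary: zs)
  case Nil
  define a b where "a = snd v" and "b = snd w"
  have b1: "balanced (v # w # ys) (length zs)" using Nil by simp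
  have a: "1 \<le> a" "a \<le> length zs" and b: "1 \<le> b" "b \<le> Suc (length zs - a)"
    using balanced_ConsD[OF b1] balanced_ConsD(1,2)[OF balanced_ConsD(3)[OF b1]]
    by (simp_all add: a_def b_def)
  have unf: "eval_word (v # w # ys) zs = eval_word ys
      (brace (snd w) (fst w) (brace (snd v) (fst v) (take (snd v) zs) # take (snd w - 1) (drop (snd v) zs))
        # drop (snd v + snd w - 1) zs)" if "1 \<le> snd w" for v w
    using that by (cases "snd w") (simp_all add: add.commute)
  have m: "mset (take i zs) + mset (take j (drop i zs)) = mset (take (i + j) zs)" for i j
    by (simp add: take_add)
  have "brace b (fst w) (brace a (fst v) (take a zs) # take (b - 1) (drop a zs)) =
      brace a (fst v) (brace b (fst w) (take b zs) # take (a - 1) (drop b zs))"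
    by (rule braces_commuteD[OF braces_commute[OF a(1) b(1)]])
      (use a b in \<open>auto simp: m add.commute\<close>)
  then show ?case
    using unf[of w v] unf[of v w] a b by (simp add: a_def b_def add.commute)
next
  case (Cons u us)
  show ?case
    using Cons.IH[of "brace (snd u) (fst u) (take (snd u) zs) # drop (snd u) zs"]
      balanced_ConsD(3)[of u "us @ v # w # ys" "length zs"] Cons.prems by simp
qed

lemma eval_word_mset_cong:
  assumes "balanced ys (length zs)" "mset ys = mset ys'"
  shows "eval_word ys zs = eval_word ys' zs"
proof -
  (* Cut off outside balanced lists, so that F is symmetric on all lists of this length. *)
  define F where "F ys = (if balanced ys (length zs) then eval_word ys zs else 0)" for ys
  have "symmetric_at (length ys) F"
  proof (rule symmetric_at_adjacentI)
    fix us vs and v w :: "'a \<times> nat"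
    have "balanced (us @ v # w # vs) (length zs) = balanced (us @ w # v # vs) (length zs)"
      by (rule balanced_mset_cong) simp
    then show "F (us @ v # w # vs) = F (us @ w # v # vs)"
      using eval_word_adjacent_swap[of us v w vs zs] by (simp add: F_def)
  qed
  then have "F ys = F ys'" using assms(2) by (rule symmetric_atD[OF _ refl])
  then show ?thesis using assms(1) balanced_mset_cong[OF assms(2), of "length zs"]
    by (simp add: F_def)
qed

text \<open>Two adjacent entries of the stack that are both absorbed by the first derivative \<open>v\<close>, or both left by it,
can be exchanged by the symmetry of the brace or by induction. If \<open>v\<close> absorbs only one of them, some
other derivative has order at least two, by balance; it may come second, and then the two
derivatives together absorb both entries.\<close>

lemma symmetric_at_eval_word:
  assumes "balanced ys n"
  shows "symmetric_at n (eval_word ys)"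
  using assms
proof (induction ys arbitrary: n)
  case Nil
  then have "n = 1" by (simp add: balanced_def)
  then show ?case
    by (auto simp: symmetric_at_def length_Suc_conv)
next
  case (Cons v ys)
  define a y where "a = snd v" and "y = fst v"
  have a: "1 \<le> a" "a \<le> n" and bal: "balanced ys (Suc (n - a))"
    using balanced_ConsD[OF Cons.prems] by (simp_all add: a_def)
  have IH: "symmetric_at (Suc (n - a)) (eval_word ys)" by (rule Cons.IH[OF bal])
  show ?case
  proof (rule symmetric_at_adjacentI)
    fix us vs :: "'a list" and p q
    assume l: "length us + length vs + 2 = n"
    consider "length us + 2 \<le> a" | "a \<le> length us" | "a = Suc (length us)" by linarith
    then have "eval_word ys (brace a y (take a (us @ p # q # vs)) # drop a (us @ p # q # vs)) =
        eval_word ys (brace a y (take a (us @ q # p # vs)) # drop a (us @ q # p # vs))"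
    proof cases
      case 1
      then obtain k where "a = length us + 2 + k" using le_Suc_ex by blast
      then have k: "a - length us = Suc (Suc k)" by simp
      have "brace a y (take a (us @ p # q # vs)) = brace a y (take a (us @ q # p # vs))"
        by (rule brace_mset_cong) (use 1 l a k in \<open>auto\<close>)
      moreover have "drop a (us @ p # q # vs) = drop a (us @ q # p # vs)"
        using 1 k by simp
      ultimately show ?thesis by simp
    next
      case 2
      then show ?thesis
        using l by (intro symmetric_atD[OF IH]) auto
    next
      case 3
      have nl: "n - a = Suc (length vs)" using l 3 by simp
      have "\<exists>w\<in>set ys. 2 \<le> snd w"
      proof (rule ccontr)
        assume "\<not> ?thesis"
        then have "\<forall>w\<in>set ys. snd w \<le> 1" by auto
        then have "sum_list (map snd ys) \<le> length ys" by (induction ys) auto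
        then show False using bal nl by (simp add: balanced_def)
      qed
      then obtain w where w: "w \<in> set ys" "2 \<le> snd w" by blast
      then obtain ys1 ys2 where "ys = ys1 @ w # ys2" by (meson split_list)
      then have m: "mset ys = mset (w # ys1 @ ys2)" by simp
      obtain b where b: "snd w = Suc (Suc b)" using w(2) by (metis add_2_eq_Suc le_Suc_ex)
      have "balanced (w # ys1 @ ys2) (Suc (n - a))"
        using bal balanced_mset_cong[OF m] by simp
      from balanced_ConsD(2)[OF this] have bl: "b \<le> length vs" using b l 3 by simp
      have e: "eval_word ys (P # r # vs) =
          eval_word (ys1 @ ys2) (brace (snd w) (fst w) (P # r # take b vs) # drop b vs)" for P r
        using eval_word_mset_cong[OF _ m, of "P # r # vs"] bal nl b by simp
      have "brace (snd w) (fst w) (brace a y (us @ [p]) # q # take b vs) =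
          brace (snd w) (fst w) (brace a y (us @ [q]) # p # take b vs)"
        by (rule braces_exchange) (use a b bl 3 in auto)
      then show ?thesis using 3 by (simp add: e)
    qed
    then show "eval_word (v # ys) (us @ p # q # vs) = eval_word (v # ys) (us @ q # p # vs)"
      by (simp add: a_def y_def)
  qed
qed

lemma eval_word_linear_hd:
  assumes "balanced ys (Suc (length zs))"
  shows "lin (\<lambda>x. eval_word ys (x # zs))"
  using assms
proof (induction ys arbitrary: zs)
  case Nil
  show ?case by (simp add: lin_iff)
next
  case (Cons v ys)
  obtain a where a: "snd v = Suc a" using balanced_ConsD(1)[OF Cons.prems] by (cases "snd v") auto
  have al: "a \<le> length zs" and bal: "balanced ys (Suc (length (drop a zs)))"
    using balanced_ConsD(2,3)[OF Cons.prems] a by simp_all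
  have "lin (\<lambda>x. brace (Suc a) (fst v) (x # take a zs))"
    by (rule multilinear_at_hd[OF multilinear_at_brace]) (use al in simp)
  from lin_comp[OF Cons.IH[OF bal] this] show ?case by (simp add: a del: brace.simps)
qed

lemma balanced_raise:
  assumes "balanced ys n" "i < length ys"
  shows "balanced (ys[i := raise (ys ! i)]) (Suc n)"
proof -
  have "sum_list (map snd (ys[i := raise (ys ! i)])) = Suc (sum_list (map snd ys))"
    using assms(2) elem_le_sum_list[of i "map snd ys"]
    by (simp add: map_update sum_list_update raise_def)
  moreover have "\<forall>v\<in>set (ys[i := raise (ys ! i)]). 1 \<le> snd v"
    using assms(1) set_update_subset_insert[of ys i "raise (ys ! i)"]
    by (auto simp: balanced_def raise_def)
  ultimately show ?thesis using assms(1) by (simp add: balanced_def)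
qed

text \<open>The common inductive step of the Leibniz rules for \<open>z d\<close> and for \<open>D\<close>: \<open>P\<close> collects the part of
\<open>\<delta>\<close> of a brace that does not come from its arguments.\<close>

lemma slot_sum_eval_word_Cons:
  assumes bal: "balanced ys (Suc (length R))" and S: "length S = a" and \<delta>: "\<delta> (brace a y S) = P + slot_sum \<delta> (brace a y) S"
  shows "slot_sum \<delta> (eval_word ys) (brace a y S # R) =
    eval_word ys (P # R) + slot_sum \<delta> (\<lambda>zs. eval_word ys (brace a y (take a zs) # drop a zs)) (S @ R)"
proof -
  have l: "lin (\<lambda>x. eval_word ys (x # R))" by (rule eval_word_linear_hd[OF bal])
  have "slot_sum \<delta> (\<lambda>zs. eval_word ys (brace a y (take a zs) # drop a zs)) (S @ R) =
      slot_sum \<delta> (\<lambda>S. eval_word ys (brace a y S # R)) S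
      + slot_sum \<delta> (\<lambda>R. eval_word ys (brace a y S # R)) R"
    unfolding slot_sum_append
    by (intro arg_cong2[where f = "(+)"] slot_sum_cong) (simp_all add: S)
  moreover have "slot_sum \<delta> (\<lambda>S. eval_word ys (brace a y S # R)) S =
      eval_word ys (slot_sum \<delta> (brace a y) S # R)"
    by (rule slot_sum_additive[symmetric, where h = "\<lambda>x. eval_word ys (x # R)"]) (rule lin_add[OF l])
  ultimately show ?thesis using \<delta> lin_add[OF l] by (simp add: add.assoc)
qed

text \<open>The Leibniz rule for \<open>z d\<close>: where \<open>d\<close> hits an element \<open>u\<close> of \<open>A\<close>, the factor \<open>z u'\<close> becomes \<open>z \<circ> u\<close>;
where it raises a derivative, \<open>z\<close> is left as a further entry of the stack.\<close>

lemma circ_eval_word: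
  assumes "balanced ys (length zs)"
  shows "circ z (eval_word ys zs) =
    slot_sum (circ z) (eval_word ys) zs + slot_sum raise (\<lambda>vs. eval_word vs (z # zs)) ys"
  using assms
proof (induction ys arbitrary: zs)
  case Nil
  then obtain x where "zs = [x]" by (auto simp: balanced_def length_Suc_conv)
  then show ?case by simp
next
  case (Cons v ys)
  define a y where "a = snd v" and "y = fst v"
  define S R where "S = take a zs" and "R = drop a zs"
  have a: "1 \<le> a" "a \<le> length zs" and bal: "balanced ys (Suc (length R))"
    using balanced_ConsD[OF Cons.prems] by (simp_all add: a_def R_def)
  have S: "length S = a" and zs: "zs = S @ R" using a by (simp_all add: S_def R_def)
  have E: "eval_word (v # ys) = (\<lambda>zs. eval_word ys (brace a y (take a zs) # drop a zs))"
    by (simp add: fun_eq_iff a_def y_def)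
  have head: "circ z (brace a y S) = brace (Suc a) y (z # S) + slot_sum (circ z) (brace a y) S"
    by (simp add: extend_op_Cons)
  have move: "eval_word vs (z # brace a y S # R) = eval_word (v # vs) (z # zs)"
    if vs: "balanced vs (Suc (Suc (length R)))" for vs
  proof -
    have "balanced (v # vs) (Suc (length zs))"
      using vs a S by (auto simp: balanced_def a_def zs)
    then have "eval_word (v # vs) (z # zs) = eval_word (v # vs) (S @ z # R)"
      by (intro symmetric_atD[OF symmetric_at_eval_word]) (auto simp: zs)
    also have "\<dots> = eval_word vs (brace a y S # z # R)"
      by (simp add: a_def[symmetric] y_def[symmetric] S)
    also have "\<dots> = eval_word vs (z # brace a y S # R)"
      by (rule symmetric_atD[OF symmetric_at_eval_word[OF vs]]) simp_all
    finally show ?thesis by simp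
  qed
  have "circ z (eval_word (v # ys) zs) = circ z (eval_word ys (brace a y S # R))"
    by (simp add: a_def y_def S_def R_def)
  also have "\<dots> = slot_sum (circ z) (eval_word ys) (brace a y S # R)
      + slot_sum raise (\<lambda>vs. eval_word vs (z # brace a y S # R)) ys"
    by (rule Cons.IH) (simp add: bal)
  also have "slot_sum raise (\<lambda>vs. eval_word vs (z # brace a y S # R)) ys =
      slot_sum raise (\<lambda>vs. eval_word (v # vs) (z # zs)) ys"
    by (intro slot_sum_cong_nth move balanced_raise bal)
  also have "slot_sum (circ z) (eval_word ys) (brace a y S # R) =
      eval_word ys (brace (Suc a) y (z # S) # R) + slot_sum (circ z) (eval_word (v # ys)) zs"
    using slot_sum_eval_word_Cons[OF bal S head]
    by (simp add: zs E del: brace.simps eval_word.simps)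
  also have "eval_word ys (brace (Suc a) y (z # S) # R) = eval_word (raise v # ys) (z # zs)"
    by (simp add: raise_def a_def[symmetric] y_def[symmetric] S_def R_def del: brace.simps)
  finally show ?case by (simp add: add_ac del: eval_word.simps)
qed

text \<open>The brace is built from \<open>\<circ>\<close> alone, hence compatible with derivations. In the inductive step the
commutator of \<open>D\<close> with left multiplication by \<open>x\<close> is left multiplication by \<open>D x\<close>.\<close>

lemma derivation_brace:
  assumes D: "derivation_of scale circ D" and us: "length us = n"
  shows "D (brace n y us) = brace n (D y) us + slot_sum D (brace n y) us"
proof -
  have lD: "lin D" and D: "D (circ x y) = circ (D x) y + circ x (D y)" for x y
    using assms(1) by (simp_all add: derivation_of_def)
  show ?thesis using us
  proof (induction n arbitrary: us)
    case 0
    then show ?case by simp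
  next
    case (Suc n)
    then obtain x vs where us: "us = x # vs" and vs: "length vs = n" by (cases us) auto
    define B where "B = brace n y"
    define B' where "B' = brace n (D y)"
    have IH: "D (B ws) = B' ws + slot_sum D B ws" if "length ws = n" for ws
      unfolding B_def B'_def using Suc.IH that by blast
    have "D (slot_sum (circ x) B vs) = slot_sum (circ x) (\<lambda>ws. D (B ws)) vs"
      by (rule slot_sum_additive) (rule lin_add[OF lD])
    also have "\<dots> = slot_sum (circ x) (\<lambda>ws. B' ws + slot_sum D B ws) vs"
      using vs by (intro slot_sum_cong IH) simp
    also have "\<dots> = slot_sum (circ x) B' vs + slot_sum (circ x) (slot_sum D B) vs"
      by (rule slot_sum_add)
    finally have 1: "D (slot_sum (circ x) B vs) = \<dots>" .
    have "slot_sum (circ x) (slot_sum D B) vs - slot_sum D (slot_sum (circ x) B) vs =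
        slot_sum (\<lambda>u. D (circ x u)) B vs - slot_sum (\<lambda>u. circ x (D u)) B vs"
      by (rule slot_sum_commutator)
    also have "\<dots> = slot_sum (\<lambda>u. D (circ x u) - circ x (D u)) B vs"
      unfolding B_def by (rule slot_sum_diff_slots[symmetric, OF multilinear_at_brace vs])
    also have "\<dots> = slot_sum (circ (D x)) B vs" by (simp add: D)
    finally have 2: "slot_sum (circ x) (slot_sum D B) vs =
        slot_sum D (slot_sum (circ x) B) vs + slot_sum (circ (D x)) B vs" by (simp add: algebra_simps)
    show ?case
      using 1 2 IH[OF vs]
      by (simp add: us extend_op_Cons B_def[symmetric] B'_def[symmetric] lin_diff[OF lD] D circ_simps
          slot_sum_diff circ_slot_sum algebra_simps)
  qed
qed

lemma derivation_eval_word: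
  assumes D: "derivation_of scale circ D" and "balanced ys (length zs)"
  shows "D (eval_word ys zs) =
    slot_sum D (eval_word ys) zs + slot_sum (apfst D) (\<lambda>vs. eval_word vs zs) ys"
  using assms(2)
proof (induction ys arbitrary: zs)
  case Nil
  then obtain x where "zs = [x]" by (auto simp: balanced_def length_Suc_conv)
  then show ?case by simp
next
  case (Cons v ys)
  define a y where "a = snd v" and "y = fst v"
  define S R where "S = take a zs" and "R = drop a zs"
  have a: "a \<le> length zs" and bal: "balanced ys (Suc (length R))"
    using balanced_ConsD[OF Cons.prems] by (simp_all add: a_def R_def)
  have S: "length S = a" and zs: "zs = S @ R" using a by (simp_all add: S_def R_def)
  have E: "eval_word (v # ys) = (\<lambda>zs. eval_word ys (brace a y (take a zs) # drop a zs))"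
    by (simp add: fun_eq_iff a_def y_def)
  have "D (eval_word (v # ys) zs) = D (eval_word ys (brace a y S # R))"
    by (simp add: a_def y_def S_def R_def)
  also have "\<dots> = slot_sum D (eval_word ys) (brace a y S # R)
      + slot_sum (apfst D) (\<lambda>vs. eval_word vs (brace a y S # R)) ys"
    by (rule Cons.IH) (simp add: bal)
  also have "slot_sum D (eval_word ys) (brace a y S # R) =
      eval_word ys (brace a (D y) S # R) + slot_sum D (eval_word (v # ys)) zs"
    using slot_sum_eval_word_Cons[OF bal S derivation_brace[OF D S]]
    by (simp add: zs E del: eval_word.simps)
  also have "eval_word ys (brace a (D y) S # R) = eval_word (apfst D v # ys) zs"
    by (simp add: a_def[symmetric] y_def[symmetric] S_def R_def)
  finally show ?case by (simp add: add_ac a_def y_def S_def R_def)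
qed

end

section \<open>Embeddings modulo a differential ideal\<close>

text \<open>The axioms for the bracket of \<open>A\<close> need no separate computation: they hold in the differential Poisson
algebra and are inherited along the injective map.\<close>

lemma special_GD_algebra_of_embedding:
  fixes scale :: "'k::field \<Rightarrow> 'a::ab_group_add \<Rightarrow> 'a"
    and scaleP :: "'k \<Rightarrow> 'p::ab_group_add \<Rightarrow> 'p"
  assumes A: "novikov_algebra scale circ"
    and P: "differential_poisson_algebra scaleP pb dot d"
    and f: "Vector_Spaces.linear scale scaleP f" "inj f"
    and f_circ: "\<And>x y. f (circ x y) = dot (f x) (d (f y))"
    and f_br: "\<And>x y. f (br x y) = pb (f x) (f y)"
  shows "special_GD_algebra scale circ br"
proof -
  interpret A: novikov_algebra scale circ by fact
  interpret P: differential_poisson_algebra scaleP pb dot d by fact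
  interpret V: vector_space_pair scale scaleP
    by (intro vector_space_pair.intro A.vector_space_axioms P.vector_space_axioms)
  have f_add: "f (x + y) = f x + f y" and f_scale: "f (scale c x) = scaleP c (f x)" for x y c
    using f(1) by (simp_all add: Vector_Spaces.linear_iff)
  have f_zero: "f 0 = 0" using f_add[of 0 0] by simp
  have f_diff: "f (x - y) = f x - f y" for x y using f_add[of "x - y" y] by simp
  have f_eq: "x = y" if "f x = f y" for x y using f(2) that by (rule injD)
  have d: "d (dot u v) = dot (d u) v + dot u (d v)" "d (pb u v) = pb (d u) v + pb u (d v)" for u v
    using P.d_mult P.d_pb by (simp_all add: derivation_of_def)
  have pb: "pb (u + v) w = pb u w + pb v w" "pb u (v + w) = pb u v + pb u w"
      "pb (scaleP c u) w = scaleP c (pb u w)" "pb u (scaleP c w) = scaleP c (pb u w)" for u v w c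
    using P.br_bilinear by (simp_all add: bilinear_op_iff)
  have dot: "dot (u + v) w = dot u w + dot v w" "dot u (v + w) = dot u v + dot u w" for u v w
    using P.dot_bilinear by (simp_all add: bilinear_op_iff)
  have pb_anti: "pb v u = - pb u v" for u v
  proof -
    have "pb (u + v) (u + v) = pb u v + pb v u" unfolding pb by (simp add: P.br_self)
    then show ?thesis by (simp add: P.br_self eq_neg_iff_add_eq_0 add.commute)
  qed
  have "GD_algebra scale circ br"
  proof (intro GD_algebra.intro A lie_algebra.intro A.vector_space_axioms
      lie_algebra_axioms.intro GD_algebra_axioms.intro)
    show "bilinear_op scale br"
      unfolding bilinear_op_iff
      by (auto intro!: f_eq A.vector_space_axioms simp: f_br f_add f_scale pb)
    show "br x x = 0" for x by (rule f_eq) (simp add: f_br f_zero P.br_self)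
    show "br x (br y z) + br y (br z x) + br z (br x y) = 0" for x y z
      by (rule f_eq) (simp add: f_br f_zero f_add P.br_jacobi)
    show "br x (circ y z) - br z (circ y x) + circ (br y x) z - circ (br y z) x - circ y (br x z) = 0"
      for x y z
    proof (rule f_eq)
      let ?x = "f x" and ?y = "f y" and ?z = "f z"
      have neg: "dot (- u) v = - dot u v" for u v
        using dot(1)[of u "- u" v] dot(1)[of 0 0 v] by (simp add: eq_neg_iff_add_eq_0 add.commute)
      have neg': "dot u (- v) = - dot u v" for u v
        by (metis neg P.dot_commute)
      show "f (br x (circ y z) - br z (circ y x) + circ (br y x) z - circ (br y z) x - circ y (br x z)) = f 0"
        by (simp add: f_br f_circ f_zero f_add f_diff P.pb_leibniz d dot
            pb_anti[of ?x ?y] pb_anti[of ?z ?y] pb_anti[of ?z "d ?x"] neg neg')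
    qed
  qed
  moreover have "GD_subalgebra scaleP (induced_circ dot d) pb (range f)"
    unfolding GD_subalgebra_def induced_circ_def
    using V.linear_subspace_image[OF f(1) A.subspace_UNIV] f_circ f_br
    by (metis (no_types, lifting) imageE rangeI)
  moreover have "GD_isomorphism_onto scale circ br scaleP (induced_circ dot d) pb (range f) f"
    unfolding GD_isomorphism_onto_def induced_circ_def using f f_circ f_br by (simp add: bij_betw_def)
  ultimately show ?thesis using special_GD_algebraI P by blast
qed

text \<open>The quotient of \<open>R\<close> by \<open>I\<close> depends on the variables in the statement, so it cannot be a type. It is
represented on \<open>R\<close> itself: with a linear projection \<open>pr\<close> along \<open>I\<close>, all operations are followed by \<open>pr\<close>.
Since \<open>I\<close> absorbs the operations, \<open>pr\<close> may be dropped inside them, and the identities of \<open>R\<close>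
carry over.\<close>

lemma special_GD_algebra_modulo_ideal:
  fixes scale :: "'k::field \<Rightarrow> 'a::ab_group_add \<Rightarrow> 'a"
    and scaleR :: "'k \<Rightarrow> 'r::comm_ring \<Rightarrow> 'r"
  assumes A: "novikov_algebra scale circ"
    and mult: "bilinear_op scaleR ((*) :: 'r \<Rightarrow> 'r \<Rightarrow> 'r)"
    and d: "derivation_of scaleR (*) d" and \<Delta>: "derivation_of scaleR (*) \<Delta>"
    and comm: "\<And>p. \<Delta> (d p) = d (\<Delta> p)"
    and I_sub: "module.subspace scaleR I"
    and I_mult: "\<And>p q. p \<in> I \<Longrightarrow> q * p \<in> I"
    and I_d: "\<And>p. p \<in> I \<Longrightarrow> d p \<in> I" and I_\<Delta>: "\<And>p. p \<in> I \<Longrightarrow> \<Delta> p \<in> I"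
    and f_add: "\<And>x y. f (x + y) - (f x + f y) \<in> I"
    and f_scale: "\<And>c x. f (scale c x) - scaleR c (f x) \<in> I"
    and f_inj: "\<And>x. f x \<in> I \<Longrightarrow> x = 0"
    and f_circ: "\<And>x y. f (circ x y) - f x * d (f y) \<in> I"
    and f_br: "\<And>x y. f (br x y) - (\<Delta> (f x) * d (f y) - \<Delta> (f y) * d (f x)) \<in> I"
  shows "special_GD_algebra scale circ br"
proof -
  interpret A: novikov_algebra scale circ by fact
  interpret R: vector_space scaleR using mult by (simp add: bilinear_op_iff)
  interpret RR: vector_space_pair scaleR scaleR
    by (intro vector_space_pair.intro R.vector_space_axioms)
  have I_neg: "- p \<in> I" if "p \<in> I" for p
    using I_sub that by (rule R.subspace_neg)
  have I_plus: "p + q \<in> I" if "p \<in> I" "q \<in> I" for p q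
    using I_sub that by (rule R.subspace_add)
  have I_minus: "p - q \<in> I" if "p \<in> I" "q \<in> I" for p q
    using I_sub that by (rule R.subspace_diff)
  have I_mult': "p * q \<in> I" if "p \<in> I" for p q
    using I_mult[OF that, of q] by (simp add: mult.commute)
  obtain g where g: "Vector_Spaces.linear scaleR scaleR g" "range g \<subseteq> I" "\<And>p. p \<in> I \<Longrightarrow> g p = p"
    using RR.linear_exists_left_inverse_on[OF R.linear_ident I_sub] by auto
  have g_add: "g (p + q) = g p + g q" and g_scale: "g (scaleR c p) = scaleR c (g p)" for p q c
    using g(1) by (simp_all add: Vector_Spaces.linear_iff)
  define pr where "pr p = p - g p" for p
  have pr_add: "pr (p + q) = pr p + pr q" and pr_scale: "pr (scaleR c p) = scaleR c (pr p)" for p q c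
    by (simp_all add: pr_def g_add g_scale R.scale_right_diff_distrib)
  have pr_diff: "pr (p - q) = pr p - pr q" for p q
    using pr_add[of "p - q" q] by simp
  have pr_zero: "pr 0 = 0" using pr_add[of 0 0] by simp
  have pr_I: "pr p = 0" if "p \<in> I" for p using g(3)[OF that] by (simp add: pr_def)
  have pr_eq: "pr p = pr q" if "p - q \<in> I" for p q
    using pr_I[OF that] by (simp add: pr_diff)
  have pr_mod: "pr p - p \<in> I" for p
    using I_neg g(2) by (auto simp: pr_def)
  have I_of_pr: "p \<in> I" if "pr p = 0" for p
    using I_neg[OF pr_mod[of p]] that by simp

  have d_add: "d (p + q) = d p + d q" and d_scale: "d (scaleR c p) = scaleR c (d p)"
    and d_mult: "d (p * q) = d p * q + p * d q" for p q c
    using d by (simp_all add: derivation_of_def Vector_Spaces.linear_iff)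
  have \<Delta>_add: "\<Delta> (p + q) = \<Delta> p + \<Delta> q" and \<Delta>_scale: "\<Delta> (scaleR c p) = scaleR c (\<Delta> p)"
    and \<Delta>_mult: "\<Delta> (p * q) = \<Delta> p * q + p * \<Delta> q" for p q c
    using \<Delta> by (simp_all add: derivation_of_def Vector_Spaces.linear_iff)
  have d_diff: "d (p - q) = d p - d q" and \<Delta>_diff: "\<Delta> (p - q) = \<Delta> p - \<Delta> q" for p q
    using d_add[of "p - q" q] \<Delta>_add[of "p - q" q] by simp_all
  have scale_mult: "p * scaleR c q = scaleR c (p * q)" "scaleR c p * q = scaleR c (p * q)" for p q c
    using mult by (simp_all add: bilinear_op_iff)

  define b where "b p q = \<Delta> p * d q - \<Delta> q * d p" for p q
  have b_I: "b p q \<in> I" if "q \<in> I" for p q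
    unfolding b_def using that by (intro I_minus I_mult I_mult' I_d I_\<Delta>)
  have b_anti: "b q p = - b p q" for p q by (simp add: b_def)
  have b_lin: "b p (q + r) = b p q + b p r" "b (q + r) p = b q p + b r p"
      "b p (q - r) = b p q - b p r"
      "b p (scaleR c q) = scaleR c (b p q)" "b (scaleR c p) q = scaleR c (b p q)" for p q r c
    by (simp_all add: b_def d_add \<Delta>_add d_diff \<Delta>_diff d_scale \<Delta>_scale scale_mult algebra_simps
        R.scale_right_diff_distrib)
  have b_jacobi: "b p (b q r) + b q (b r p) + b r (b p q) = 0" for p q r
    by (simp add: b_def d_diff \<Delta>_diff d_mult \<Delta>_mult comm algebra_simps)
  have b_mult: "b p (q * r) = b p q * r + q * b p r" for p q r
    by (simp add: b_def d_mult \<Delta>_mult algebra_simps)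
  have d_b: "d (b p q) = b (d p) q + b p (d q)" for p q
    by (simp add: b_def d_diff d_mult comm algebra_simps)

  define dot where "dot p q = pr (p * q)" for p q
  define pb where "pb p q = pr (b p q)" for p q
  define d' where "d' p = pr (d p)" for p
  have pr_mult: "pr (p * pr q) = pr (p * q)" "pr (pr q * p) = pr (q * p)" for p q
  proof -
    show "pr (p * pr q) = pr (p * q)"
      using I_mult[OF pr_mod[of q], of p] by (intro pr_eq) (simp add: right_diff_distrib)
    then show "pr (pr q * p) = pr (q * p)" by (simp add: mult.commute)
  qed
  have pr_b: "pr (b p (pr q)) = pr (b p q)" "pr (b (pr q) p) = pr (b q p)" for p q
  proof -
    show *: "pr (b p (pr q)) = pr (b p q)"
      using b_I[OF pr_mod[of q], of p] by (intro pr_eq) (simp add: b_lin)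
    have "pr (- u) = - pr u" for u using pr_diff[of 0 u] by (simp add: pr_zero)
    then show "pr (b (pr q) p) = pr (b q p)" using * by (simp add: b_anti[of p])
  qed
  have pr_d: "pr (d (pr q)) = pr (d q)" for q
    using I_d[OF pr_mod[of q]] by (intro pr_eq) (simp add: d_diff)
  note pr_simps = pr_mult pr_b pr_d
  have d'_lin: "Vector_Spaces.linear scaleR scaleR d'"
    unfolding Vector_Spaces.linear_iff d'_def
    using R.vector_space_axioms by (simp add: d_add d_scale pr_add pr_scale)
  have "differential_poisson_algebra scaleR pb dot d'"
  proof (intro differential_poisson_algebra.intro poisson_algebra.intro lie_algebra.intro
      R.vector_space_axioms lie_algebra_axioms.intro poisson_algebra_axioms.intro
      differential_poisson_algebra_axioms.intro)
    show "bilinear_op scaleR pb" "bilinear_op scaleR dot"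
      unfolding bilinear_op_iff dot_def pb_def using R.vector_space_axioms
      by (simp_all add: b_lin scale_mult distrib_left distrib_right pr_add pr_scale)
    show "pb p p = 0" for p by (simp add: pb_def b_def pr_zero)
    show "pb p (pb q r) + pb q (pb r p) + pb r (pb p q) = 0" for p q r
      by (simp add: pb_def pr_simps b_jacobi pr_zero flip: pr_add)
    show "dot p q = dot q p" for p q by (simp add: dot_def mult.commute)
    show "dot (dot p q) r = dot p (dot q r)" for p q r by (simp add: dot_def pr_simps mult.assoc)
    show "pb p (dot q r) = dot (pb p q) r + dot q (pb p r)" for p q r
      by (simp add: dot_def pb_def pr_simps b_mult flip: pr_add)
    show "derivation_of scaleR dot d'" "derivation_of scaleR pb d'"
      unfolding derivation_of_def using d'_lin
      by (simp_all add: dot_def pb_def d'_def pr_simps d_mult d_b flip: pr_add)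
  qed
  moreover have "Vector_Spaces.linear scale scaleR (\<lambda>x. pr (f x))"
    unfolding Vector_Spaces.linear_iff
    using A.vector_space_axioms R.vector_space_axioms pr_eq[OF f_add] pr_eq[OF f_scale]
    by (simp add: pr_add pr_scale)
  moreover have "inj (\<lambda>x. pr (f x))"
  proof (rule injI)
    fix x y assume "pr (f x) = pr (f y)"
    moreover have "pr (f x) = pr (f (x - y)) + pr (f y)"
      using pr_eq[OF f_add, of "x - y" y] by (simp add: pr_add)
    ultimately have "pr (f (x - y)) = 0" by simp
    then have "x - y = 0" by (intro f_inj I_of_pr)
    then show "x = y" by simp
  qed
  moreover have "pr (f (circ x y)) = dot (pr (f x)) (d' (pr (f y)))" for x y
    by (simp add: dot_def d'_def pr_simps pr_eq[OF f_circ])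
  moreover have "pr (f (br x y)) = pb (pr (f x)) (pr (f y))" for x y
    using pr_eq[OF f_br, of x y] unfolding b_def[symmetric] by (simp add: pb_def pr_simps)
  ultimately show ?thesis
    using special_GD_algebra_of_embedding[OF A] by blast
qed

section \<open>Polynomials and the derivations that replace variables\<close>

type_synonym ('v, 'k) mpoly = "'v multiset \<Rightarrow>\<^sub>0 'k"

abbreviation mmonom :: "'v multiset \<Rightarrow> ('v, 'k::field) mpoly" where
  "mmonom m \<equiv> Poly_Mapping.single m 1"

interpretation W: vector_space word_scale
  by (rule vector_space_word_scale)

lemma mpoly_scale_mult: "word_scale c p * q = word_scale c (p * q)" "p * word_scale c q = word_scale c (p * q)"
  for p q :: "('v, 'k::field) mpoly"
  by (simp_all add: word_scale_def mult_map_scale_conv_mult mult_ac)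

lemma mmonom_mult: "mmonom m * mmonom n = (mmonom (m + n) :: ('v, 'k::field) mpoly)"
  by (simp add: mult_single)

lemma mmonom_expansion:
  "p = (\<Sum>m\<in>Poly_Mapping.keys p. word_scale (Poly_Mapping.lookup p m) (mmonom m))"
proof (rule poly_mapping_eqI)
  fix n
  show "Poly_Mapping.lookup p n =
      Poly_Mapping.lookup (\<Sum>m\<in>Poly_Mapping.keys p. word_scale (Poly_Mapping.lookup p m) (mmonom m)) n"
    by (simp add: lookup_sum lookup_word_scale lookup_single when_def in_keys_iff if_distrib[of "(*) _"] cong: if_cong)
qed

lemma mpoly_linear_eqI:
  assumes f: "Vector_Spaces.linear word_scale scale f" and g: "Vector_Spaces.linear word_scale scale g"
    and eq: "\<And>m. f (mmonom m) = g (mmonom m)"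
  shows "f p = g p"
proof -
  interpret f: Vector_Spaces.linear word_scale scale f by fact
  interpret g: Vector_Spaces.linear word_scale scale g by fact
  have "f (\<Sum>m\<in>Poly_Mapping.keys p. word_scale (Poly_Mapping.lookup p m) (mmonom m)) =
      g (\<Sum>m\<in>Poly_Mapping.keys p. word_scale (Poly_Mapping.lookup p m) (mmonom m))"
    by (simp add: f.sum g.sum f.scale g.scale eq)
  then show ?thesis by (simp only: mmonom_expansion[symmetric])
qed

definition extend_linear ::
  "('k::field \<Rightarrow> 'w::ab_group_add \<Rightarrow> 'w) \<Rightarrow> ('v multiset \<Rightarrow> 'w) \<Rightarrow> ('v, 'k) mpoly \<Rightarrow> 'w" where
  "extend_linear scale g p = (\<Sum>m\<in>Poly_Mapping.keys p. scale (Poly_Mapping.lookup p m) (g m))"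

lemma extend_linear_mmonom:
  fixes scale :: "'k::field \<Rightarrow> 'w::ab_group_add \<Rightarrow> 'w" and g :: "'v multiset \<Rightarrow> 'w"
  assumes "vector_space scale"
  shows "extend_linear scale g (mmonom m) = g m"
proof -
  interpret vector_space scale by fact
  show ?thesis by (simp add: extend_linear_def)
qed

lemma linear_extend_linear:
  fixes scale :: "'k::field \<Rightarrow> 'w::ab_group_add \<Rightarrow> 'w" and g :: "'v multiset \<Rightarrow> 'w"
  assumes "vector_space scale"
  shows "Vector_Spaces.linear word_scale scale (extend_linear scale g)"
proof -
  interpret vector_space scale by fact
  have sup: "extend_linear scale g p = (\<Sum>m\<in>A. scale (Poly_Mapping.lookup p m) (g m))"
    if "finite A" "Poly_Mapping.keys p \<subseteq> A" for p :: "('v, 'k) mpoly" and A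
    unfolding extend_linear_def using that by (intro sum.mono_neutral_left) (auto simp: in_keys_iff)
  show ?thesis
    unfolding Vector_Spaces.linear_iff
  proof (intro conjI allI assms vector_space_word_scale)
    fix p q :: "('v, 'k) mpoly"
    let ?A = "Poly_Mapping.keys p \<union> Poly_Mapping.keys q"
    have "Poly_Mapping.keys (p + q) \<subseteq> ?A" by (rule Poly_Mapping.keys_add)
    then show "extend_linear scale g (p + q) = extend_linear scale g p + extend_linear scale g q"
      by (simp add: sup[of ?A] lookup_add scale_left_distrib sum.distrib)
  next
    fix c and p :: "('v, 'k) mpoly"
    have "Poly_Mapping.keys (word_scale c p) \<subseteq> Poly_Mapping.keys p"
      by (auto simp: in_keys_iff lookup_word_scale)
    then show "extend_linear scale g (word_scale c p) = scale c (extend_linear scale g p)"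
      by (simp add: sup[of "Poly_Mapping.keys p"] lookup_word_scale scale_sum_right)
  qed
qed

text \<open>The image of a monomial under the derivation that sends every variable \<open>v\<close> to the variable \<open>\<delta> v\<close>.\<close>

definition replace_one :: "('v \<Rightarrow> 'v) \<Rightarrow> 'v multiset \<Rightarrow> ('v, 'k::field) mpoly" where
  "replace_one \<delta> m = (\<Sum>v\<in>#m. mmonom (add_mset (\<delta> v) (m - {#v#})))"

lemma replace_one_empty [simp]: "replace_one \<delta> {#} = 0"
  by (simp add: replace_one_def)

lemma replace_one_add_mset:
  "replace_one \<delta> (add_mset v m) = mmonom (add_mset (\<delta> v) m) + mmonom {#v#} * replace_one \<delta> m"
proof -
  have "add_mset v m - {#u#} = add_mset v (m - {#u#})" if "u \<in># m" for u
    using diff_union_single_conv[OF that, of "{#v#}"] by simp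
  then have "replace_one \<delta> (add_mset v m) = mmonom (add_mset (\<delta> v) m)
      + (\<Sum>u\<in>#m. mmonom {#v#} * mmonom (add_mset (\<delta> u) (m - {#u#})))"
    unfolding replace_one_def
    by (auto simp: mmonom_mult add_mset_commute intro!: arg_cong[where f = sum_mset] image_mset_cong)
  then show ?thesis by (simp add: replace_one_def sum_mset_distrib_left)
qed

lemma replace_one_mset:
  "replace_one \<delta> (mset xs) = (slot_sum \<delta> (\<lambda>l. mmonom (mset l)) xs :: ('v, 'k::field) mpoly)"
proof (induction xs)
  case (Cons x xs)
  have "slot_sum \<delta> (\<lambda>l. mmonom (mset (x # l))) xs =
      (slot_sum \<delta> (\<lambda>l. mmonom {#x#} * mmonom (mset l)) xs :: ('v, 'k) mpoly)"
    by (simp add: mmonom_mult)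
  also have "\<dots> = mmonom {#x#} * slot_sum \<delta> (\<lambda>l. mmonom (mset l)) xs"
    by (rule slot_sum_additive[symmetric]) (rule distrib_left)
  finally show ?case by (simp add: replace_one_add_mset Cons.IH)
qed simp

definition mpoly_deriv :: "('v \<Rightarrow> 'v) \<Rightarrow> ('v, 'k::field) mpoly \<Rightarrow> ('v, 'k) mpoly" where
  "mpoly_deriv \<delta> = extend_linear word_scale (replace_one \<delta>)"

lemma mpoly_deriv_mmonom [simp]: "mpoly_deriv \<delta> (mmonom m) = replace_one \<delta> m"
  unfolding mpoly_deriv_def by (rule extend_linear_mmonom[OF vector_space_word_scale])

lemma linear_mpoly_deriv: "Vector_Spaces.linear word_scale word_scale (mpoly_deriv \<delta>)"
  unfolding mpoly_deriv_def by (rule linear_extend_linear[OF vector_space_word_scale])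

lemma mpoly_deriv_add: "mpoly_deriv \<delta> (p + q) = mpoly_deriv \<delta> p + mpoly_deriv \<delta> q"
  and mpoly_deriv_scale: "mpoly_deriv \<delta> (word_scale c p) = word_scale c (mpoly_deriv \<delta> p)"
  using linear_mpoly_deriv unfolding Vector_Spaces.linear_iff by blast+

lemma mpoly_deriv_zero [simp]: "mpoly_deriv \<delta> 0 = 0"
  using mpoly_deriv_add[of \<delta> 0 0] by simp

lemma mpoly_deriv_one [simp]: "mpoly_deriv \<delta> 1 = 0"
  using mpoly_deriv_mmonom[of \<delta> "{#}"] by simp

lemma bilinear_op_mpoly_mult: "bilinear_op word_scale ((*) :: ('v, 'k::field) mpoly \<Rightarrow> _)"
  by (simp add: bilinear_op_iff vector_space_word_scale distrib_left distrib_right mpoly_scale_mult)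

lemma mpoly_deriv_mult:
  fixes p q :: "('v, 'k::field) mpoly"
  shows "mpoly_deriv \<delta> (p * q) = mpoly_deriv \<delta> p * q + p * mpoly_deriv \<delta> q"
proof -
  note lin_defs = Vector_Spaces.linear_iff vector_space_word_scale mpoly_deriv_add mpoly_deriv_scale
    distrib_left distrib_right mpoly_scale_mult W.scale_right_distrib add_ac
  have mm: "mpoly_deriv \<delta> (mmonom m * mmonom n :: ('v, 'k) mpoly) = mpoly_deriv \<delta> (mmonom m) * mmonom n + mmonom m * mpoly_deriv \<delta> (mmonom n)"
    for m n
  proof (induction m)
    case empty
    show ?case by simp
  next
    case (add v m)
    have "mpoly_deriv \<delta> (mmonom (add_mset v m) * mmonom n) =
        (replace_one \<delta> (add_mset v (m + n)) :: ('v, 'k) mpoly)"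
      by (simp add: mmonom_mult)
    also have "\<dots> = mmonom (add_mset (\<delta> v) (m + n)) + mmonom {#v#} * replace_one \<delta> (m + n)"
      by (rule replace_one_add_mset)
    also have "replace_one \<delta> (m + n) = (replace_one \<delta> m * mmonom n + mmonom m * replace_one \<delta> n :: ('v, 'k) mpoly)"
      using add.IH by (simp add: mmonom_mult)
    also have "mmonom (add_mset (\<delta> v) (m + n)) = (mmonom (add_mset (\<delta> v) m) * mmonom n :: ('v, 'k) mpoly)"
      by (simp add: mmonom_mult)
    also have "mmonom (add_mset (\<delta> v) m) * mmonom n
        + mmonom {#v#} * (replace_one \<delta> m * mmonom n + mmonom m * replace_one \<delta> n) =
        (mmonom (add_mset (\<delta> v) m) + mmonom {#v#} * replace_one \<delta> m) * mmonom n
        + (mmonom {#v#} * mmonom m) * replace_one \<delta> n"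
      by (simp only: distrib_left distrib_right mult.assoc add.assoc)
    finally show ?case by (simp add: mmonom_mult replace_one_add_mset)
  qed
  have lin_left: "Vector_Spaces.linear word_scale word_scale (\<lambda>p. mpoly_deriv \<delta> (p * r))"
      "Vector_Spaces.linear word_scale word_scale (\<lambda>p. mpoly_deriv \<delta> p * r + p * r')"
    and lin_right: "Vector_Spaces.linear word_scale word_scale (\<lambda>q. mpoly_deriv \<delta> (r * q))"
      "Vector_Spaces.linear word_scale word_scale (\<lambda>q. r' * q + r * mpoly_deriv \<delta> q)"
    for r r' :: "('v, 'k) mpoly"
    by (simp_all add: lin_defs)
  have "mpoly_deriv \<delta> (p * mmonom n) = mpoly_deriv \<delta> p * mmonom n + p * mpoly_deriv \<delta> (mmonom n)" for n
    by (rule mpoly_linear_eqI[OF lin_left mm])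
  from mpoly_linear_eqI[OF lin_right this] show ?thesis .
qed

lemma derivation_mpoly_deriv: "derivation_of word_scale (*) (mpoly_deriv \<delta>)"
  unfolding derivation_of_def using linear_mpoly_deriv mpoly_deriv_mult by blast

text \<open>The commutator of two derivations is a derivation, so it is enough that they commute on the variables.\<close>

lemma mpoly_deriv_commute:
  fixes p :: "('v, 'k::field) mpoly"
  assumes "\<And>v. \<delta> (\<epsilon> v) = \<epsilon> (\<delta> v)"
  shows "mpoly_deriv \<delta> (mpoly_deriv \<epsilon> p) = mpoly_deriv \<epsilon> (mpoly_deriv \<delta> p)"
proof (rule mpoly_linear_eqI[where scale = word_scale and f = "\<lambda>p. mpoly_deriv \<delta> (mpoly_deriv \<epsilon> p)"
      and g = "\<lambda>p. mpoly_deriv \<epsilon> (mpoly_deriv \<delta> p)"])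
  show "mpoly_deriv \<delta> (mpoly_deriv \<epsilon> (mmonom m :: ('v, 'k) mpoly)) =
      mpoly_deriv \<epsilon> (mpoly_deriv \<delta> (mmonom m))" for m
  proof (induction m)
    case empty
    show ?case by simp
  next
    case (add v m)
    have split: "mmonom (add_mset v m) = (mmonom {#v#} * mmonom m :: ('v, 'k) mpoly)" by (simp add: mmonom_mult)
    show ?case
      unfolding split mpoly_deriv_mult mpoly_deriv_add add.IH
      by (simp add: replace_one_add_mset assms add_ac)
  qed
qed (simp_all add: Vector_Spaces.linear_iff vector_space_word_scale mpoly_deriv_add mpoly_deriv_scale)

section \<open>The evaluation of polynomials in a Novikov algebra\<close>

text \<open>The weight is -1 on elements of \<open>A\<close>, is additive on products and is raised by one by \<open>d\<close>, so
that \<open>x d(y)\<close> has the weight of \<open>x\<close> and of \<open>y\<close>.\<close>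

definition weight :: "('v \<times> nat) multiset \<Rightarrow> int" where
  "weight m = (\<Sum>v\<in>#m. int (snd v) - 1)"

lemma weight_simps [simp]:
  "weight {#} = 0" "weight (add_mset v m) = int (snd v) - 1 + weight m" "weight (m + n) = weight m + weight n"
  by (simp_all add: weight_def)

lemma weight_replace:
  assumes "i < length l" "int (snd (\<delta> (l ! i))) = int (snd (l ! i)) + k"
  shows "weight (mset (l[i := \<delta> (l ! i)])) = weight (mset l) + k"
proof -
  have "l = take i l @ l ! i # drop (Suc i) l" using assms(1) by (rule id_take_nth_drop)
  then have "weight (mset l) = weight (mset (take i l @ l ! i # drop (Suc i) l))" by simp
  then show ?thesis using assms by (simp add: upd_conv_take_nth_drop del: append_take_drop_id)
qed

lemma weight_raise: "i < length l \<Longrightarrow> weight (mset (l[i := raise (l ! i)])) = weight (mset l) + 1"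
  by (rule weight_replace) (simp_all add: raise_def)

definition zeros :: "'v list \<Rightarrow> ('v \<times> nat) list" where
  "zeros zs = map (\<lambda>z. (z, 0)) zs"

lemma zeros_simps [simp]: "zeros [] = []" "zeros (z # zs) = (z, 0) # zeros zs"
  "zeros (zs @ zs') = zeros zs @ zeros zs'" "length (zeros zs) = length zs"
  by (simp_all add: zeros_def)

lemma split_zeros:
  "\<exists>zs ys. m = mset (zeros zs @ ys) \<and> (\<forall>v\<in>set ys. 1 \<le> snd v)"
proof (induction m)
  case empty
  show ?case by (intro exI[of _ "[]"]) simp
next
  case (add v m)
  then obtain zs ys where m: "m = mset (zeros zs @ ys)" and pos: "\<forall>v\<in>set ys. 1 \<le> snd v" by blast
  show ?case
  proof (cases "snd v = 0")
    case True
    then have "add_mset v m = mset (zeros (fst v # zs) @ ys)" using m by (cases v) simp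
    with pos show ?thesis by blast
  next
    case False
    then have "add_mset v m = mset (zeros zs @ v # ys)" "\<forall>u\<in>set (v # ys). 1 \<le> snd u"
      using m pos by simp_all
    then show ?thesis by blast
  qed
qed

lemma split_zeros_unique:
  assumes pos: "\<forall>v\<in>set ys. 1 \<le> snd v" "\<forall>v\<in>set ys'. 1 \<le> snd v"
    and eq: "mset (zeros zs @ ys) = mset (zeros zs' @ ys')"
  shows "mset zs = mset zs'" "mset ys = mset ys'"
proof -
  have z: "filter_mset (\<lambda>v. snd v = 0) (mset (zeros zs)) = mset (zeros zs)"
    "filter_mset (\<lambda>v. snd v \<noteq> 0) (mset (zeros zs)) = {#}" for zs :: "'a list"
    by (auto simp: zeros_def filter_mset_eq_conv)
  have y: "filter_mset (\<lambda>v. snd v = 0) (mset ys) = {#}"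
    "filter_mset (\<lambda>v. snd v \<noteq> 0) (mset ys) = mset ys" if "\<forall>v\<in>set ys. 1 \<le> snd v" for ys :: "('a \<times> nat) list"
    using that by (auto simp: filter_mset_eq_conv)
  have "mset (zeros zs) = mset (zeros zs')"
    using arg_cong[OF eq, of "filter_mset (\<lambda>v. snd v = 0)"]
    unfolding mset_append filter_union_mset z y[OF pos(1)] y[OF pos(2)] by simp
  from arg_cong[OF this, of "image_mset fst"] show "mset zs = mset zs'"
    by (simp add: zeros_def image_mset.compositionality comp_def)
  show "mset ys = mset ys'"
    using arg_cong[OF eq, of "filter_mset (\<lambda>v. snd v \<noteq> 0)"]
    unfolding mset_append filter_union_mset z y[OF pos(1)] y[OF pos(2)] by simp
qed

context novikov_algebra
begin

lemma weight_zeros_append: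
  "weight (mset (zeros zs @ ys)) = int (sum_list (map snd ys)) - int (length ys) - int (length zs)"
proof -
  have "weight (mset (zeros zs)) = - int (length zs)" by (induction zs) simp_all
  moreover have "weight (mset ys) = int (sum_list (map snd ys)) - int (length ys)"
    by (induction ys) simp_all
  ultimately show ?thesis by simp
qed

lemma balanced_iff_weight:
  assumes "\<forall>v\<in>set ys. 1 \<le> snd v"
  shows "balanced ys (length zs) \<longleftrightarrow> weight (mset (zeros zs @ ys)) = -1"
  unfolding weight_zeros_append balanced_def using assms by auto

text \<open>The factors of a monomial come in no order, so an arbitrary one is chosen; by the symmetry of
\<open>eval_word\<close> the choice does not matter (\<open>eval_mmonom_balanced\<close>). Products of another weight cannot
represent elements of \<open>A\<close> and are sent to 0.\<close>

definition eval_mmonom :: "('a \<times> nat) multiset \<Rightarrow> 'a" where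
  "eval_mmonom m = (if weight m = -1
     then let (zs, ys) = SOME (zs, ys). m = mset (zeros zs @ ys) \<and> (\<forall>v\<in>set ys. 1 \<le> snd v) in eval_word ys zs
     else 0)"

lemma eval_mmonom_eq_0: "weight m \<noteq> -1 \<Longrightarrow> eval_mmonom m = 0"
  by (simp add: eval_mmonom_def)

lemma eval_mmonom_balanced:
  assumes bal: "balanced ys (length zs)" and m: "m = mset (zeros zs @ ys)"
  shows "eval_mmonom m = eval_word ys zs"
proof -
  define P where "P = (\<lambda>(zs, ys). m = mset (zeros zs @ ys) \<and> (\<forall>v\<in>set ys. 1 \<le> snd v))"
  have pos: "\<forall>v\<in>set ys. 1 \<le> snd v" using bal by (simp add: balanced_def)
  have "P (zs, ys)" using m pos by (simp add: P_def)
  then have "P (SOME p. P p)" by (rule someI)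
  then obtain zs' ys' where p: "(SOME p. P p) = (zs', ys')" and m': "m = mset (zeros zs' @ ys')"
    and pos': "\<forall>v\<in>set ys'. 1 \<le> snd v"
    by (cases "SOME p. P p") (auto simp: P_def)
  have eq: "mset zs = mset zs'" "mset ys = mset ys'"
    using split_zeros_unique[OF pos pos'] m m' by metis+
  have "weight m = -1" using bal m balanced_iff_weight[OF pos] by simp
  then have "eval_mmonom m = eval_word ys' zs'"
    using p by (simp add: eval_mmonom_def P_def)
  also have "\<dots> = eval_word ys' zs"
    by (rule symmetric_atD[OF symmetric_at_eval_word, symmetric])
      (use bal eq balanced_mset_cong[OF eq(2)] in auto)
  also have "\<dots> = eval_word ys zs"
    using eval_word_mset_cong[OF bal eq(2)] by simp
  finally show ?thesis .
qed

definition eval_mpoly :: "('a \<times> nat, 'k) mpoly \<Rightarrow> 'a" where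
  "eval_mpoly = extend_linear scale eval_mmonom"

lemma eval_mpoly_mmonom [simp]: "eval_mpoly (mmonom m) = eval_mmonom m"
  unfolding eval_mpoly_def by (rule extend_linear_mmonom[OF vector_space_axioms])

lemma linear_eval_mpoly: "Vector_Spaces.linear word_scale scale eval_mpoly"
  unfolding eval_mpoly_def by (rule linear_extend_linear[OF vector_space_axioms])

lemma eval_mpoly_add: "eval_mpoly (p + q) = eval_mpoly p + eval_mpoly q"
  and eval_mpoly_scale: "eval_mpoly (word_scale c p) = scale c (eval_mpoly p)"
  using linear_eval_mpoly unfolding Vector_Spaces.linear_iff by blast+

lemma eval_mpoly_diff: "eval_mpoly (p - q) = eval_mpoly p - eval_mpoly q"
  using eval_mpoly_add[of "p - q" q] by simp

lemma eval_mpoly_zero [simp]: "eval_mpoly 0 = 0"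
  using eval_mpoly_add[of 0 0] by simp

lemma eval_mpoly_generator: "eval_mpoly (mmonom {#(x, 0)#}) = x"
proof -
  have "balanced [] (length [x])" by (simp add: balanced_def)
  then show ?thesis using eval_mmonom_balanced[of "[]" "[x]"] by simp
qed

text \<open>On monomials this is the Leibniz rule for \<open>eval_word\<close>: a factor \<open>u\<close> without derivative becomes \<open>u'\<close>, which,
taken first, absorbs \<open>z\<close> and leaves \<open>z \<circ> u\<close> in the place of \<open>u\<close>.\<close>

lemma eval_mpoly_circ:
  "eval_mpoly (mmonom {#(z, 0)#} * mpoly_deriv raise p) = circ z (eval_mpoly p)"
proof (rule mpoly_linear_eqI[where scale = scale])
  show "Vector_Spaces.linear word_scale scale (\<lambda>p. eval_mpoly (mmonom {#(z, 0)#} * mpoly_deriv raise p))"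
    unfolding Vector_Spaces.linear_iff
    by (simp add: vector_space_word_scale vector_space_axioms mpoly_deriv_add mpoly_deriv_scale
        distrib_left mpoly_scale_mult eval_mpoly_add eval_mpoly_scale)
  show "Vector_Spaces.linear word_scale scale (\<lambda>p. circ z (eval_mpoly p))"
    unfolding Vector_Spaces.linear_iff
    by (simp add: vector_space_word_scale vector_space_axioms eval_mpoly_add eval_mpoly_scale
        circ_simps lin_scale[OF circ_lin_right])
next
  fix m :: "('a \<times> nat) multiset"
  obtain zs ys where m: "m = mset (zeros zs @ ys)" and pos: "\<forall>v\<in>set ys. 1 \<le> snd v"
    using split_zeros by blast
  define F where "F l = eval_mmonom (add_mset (z, 0) (mset l))" for l
  have "mmonom {#(z, 0)#} * replace_one raise m =
      (slot_sum raise (\<lambda>l. mmonom {#(z, 0)#} * mmonom (mset l)) (zeros zs @ ys) :: ('a \<times> nat, 'k) mpoly)"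
    unfolding m replace_one_mset by (rule slot_sum_additive) (rule distrib_left)
  then have "eval_mpoly (mmonom {#(z, 0)#} * replace_one raise m) =
      slot_sum raise (\<lambda>l. eval_mpoly (mmonom {#(z, 0)#} * mmonom (mset l))) (zeros zs @ ys)"
    by (simp only:) (rule slot_sum_additive, rule eval_mpoly_add)
  then have expand: "eval_mpoly (mmonom {#(z, 0)#} * replace_one raise m) = slot_sum raise F (zeros zs @ ys)"
    by (simp add: mmonom_mult F_def[abs_def])
  show "eval_mpoly (mmonom {#(z, 0)#} * mpoly_deriv raise (mmonom m)) = circ z (eval_mpoly (mmonom m))"
  proof (cases "balanced ys (length zs)")
    case bal: True
    have "slot_sum raise (\<lambda>us. F (us @ ys)) (zeros zs) = slot_sum (circ z) (eval_word ys) zs"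
      unfolding slot_sum_def
    proof (intro sum.cong)
      fix i assume "i \<in> {..<length zs}"
      then have i: "i < length zs" by simp
      define us x vs where "us = take i zs" and "x = zs ! i" and "vs = drop (Suc i) zs"
      have zs: "zs = us @ x # vs" and lus: "length us = i"
        using id_take_nth_drop[OF i] i by (simp_all add: us_def x_def vs_def)
      have "length (zeros us) = i" using lus by simp
      then have "(zeros zs)[i := raise (zeros zs ! i)] = zeros us @ (x, 1) # zeros vs"
        by (simp add: zs nth_append list_update_append raise_def)
      then have "F ((zeros zs)[i := raise (zeros zs ! i)] @ ys) = eval_mmonom (mset (zeros (z # us @ vs) @ (x, 1) # ys))"
        by (simp add: F_def)
      also have "\<dots> = eval_word ((x, 1) # ys) (z # us @ vs)"
        by (rule eval_mmonom_balanced) (use bal zs in \<open>auto simp: balanced_def\<close>)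
      also have "\<dots> = eval_word ys (circ z x # us @ vs)"
        by (simp add: extend_op_Cons)
      also have "\<dots> = eval_word ys (us @ circ z x # vs)"
        by (rule symmetric_atD[OF symmetric_at_eval_word[OF bal]]) (simp_all add: zs)
      also have "us @ circ z x # vs = zs[i := circ z (zs ! i)]"
        using lus by (simp add: zs list_update_append nth_append)
      finally show "F ((zeros zs)[i := raise (zeros zs ! i)] @ ys) = eval_word ys (zs[i := circ z (zs ! i)])" .
    qed simp
    moreover have "slot_sum raise (\<lambda>vs. F (zeros zs @ vs)) ys = slot_sum raise (\<lambda>vs. eval_word vs (z # zs)) ys"
    proof (rule slot_sum_cong_nth)
      fix i assume "i < length ys"
      then have "balanced (ys[i := raise (ys ! i)]) (length (z # zs))"
        using balanced_raise[OF bal] by simp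
      then show "F (zeros zs @ ys[i := raise (ys ! i)]) = eval_word (ys[i := raise (ys ! i)]) (z # zs)"
        unfolding F_def by (rule eval_mmonom_balanced) simp
    qed
    ultimately show ?thesis
      unfolding mpoly_deriv_mmonom expand slot_sum_append
      by (simp add: circ_eval_word[OF bal] eval_mmonom_balanced[OF bal m])
  next
    case False
    then have w: "weight (mset (zeros zs @ ys)) \<noteq> -1" using balanced_iff_weight[OF pos] by blast
    have "slot_sum raise F (zeros zs @ ys) = 0"
      unfolding slot_sum_def F_def
      by (intro sum.neutral ballI eval_mmonom_eq_0)
        (use w in \<open>simp add: weight_raise del: mset_append\<close>)
    then show ?thesis
      using expand w by (simp add: m eval_mmonom_eq_0 lin_zero[OF circ_lin_right] del: mset_append)
  qed
qed

text \<open>Since \<open>eval_word\<close> is built from \<open>\<circ>\<close> alone, derivations pass through it. Hence the kernel of the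
evaluation is stable under the extension of \<open>D\<close> to polynomials.\<close>

lemma eval_mpoly_derivation:
  assumes D: "derivation_of scale circ D"
  shows "eval_mpoly (mpoly_deriv (apfst D) p) = D (eval_mpoly p)"
proof (rule mpoly_linear_eqI[where scale = scale])
  have lD: "lin D" using D by (simp add: derivation_of_def)
  show "Vector_Spaces.linear word_scale scale (\<lambda>p. eval_mpoly (mpoly_deriv (apfst D) p))"
    unfolding Vector_Spaces.linear_iff
    by (simp add: vector_space_word_scale vector_space_axioms mpoly_deriv_add mpoly_deriv_scale
        eval_mpoly_add eval_mpoly_scale)
  show "Vector_Spaces.linear word_scale scale (\<lambda>p. D (eval_mpoly p))"
    unfolding Vector_Spaces.linear_iff
    by (simp add: vector_space_word_scale vector_space_axioms eval_mpoly_add eval_mpoly_scale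
        lin_add[OF lD] lin_scale[OF lD])
  fix m :: "('a \<times> nat) multiset"
  obtain zs ys where m: "m = mset (zeros zs @ ys)" and pos: "\<forall>v\<in>set ys. 1 \<le> snd v"
    using split_zeros by blast
  have "eval_mpoly (replace_one (apfst D) m) =
      slot_sum (apfst D) (\<lambda>l. eval_mpoly (mmonom (mset l))) (zeros zs @ ys)"
    unfolding m replace_one_mset by (rule slot_sum_additive, rule eval_mpoly_add)
  then have expand: "eval_mpoly (replace_one (apfst D) m) =
      slot_sum (apfst D) (\<lambda>l. eval_mmonom (mset l)) (zeros zs @ ys)" by simp
  show "eval_mpoly (mpoly_deriv (apfst D) (mmonom m)) = D (eval_mpoly (mmonom m))"
  proof (cases "balanced ys (length zs)")
    case bal: True
    have "slot_sum (apfst D) (\<lambda>us. eval_mmonom (mset (us @ ys))) (zeros zs) = slot_sum D (eval_word ys) zs"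
      unfolding slot_sum_def
    proof (intro sum.cong)
      fix i assume "i \<in> {..<length zs}"
      then have "(zeros zs)[i := apfst D (zeros zs ! i)] = zeros (zs[i := D (zs ! i)])"
        by (simp add: zeros_def map_update)
      then show "eval_mmonom (mset ((zeros zs)[i := apfst D (zeros zs ! i)] @ ys)) =
          eval_word ys (zs[i := D (zs ! i)])"
        by (intro eval_mmonom_balanced) (simp_all add: bal)
    qed simp
    moreover have "slot_sum (apfst D) (\<lambda>vs. eval_mmonom (mset (zeros zs @ vs))) ys =
        slot_sum (apfst D) (\<lambda>vs. eval_word vs zs) ys"
    proof (rule slot_sum_cong_nth)
      fix i assume i: "i < length ys"
      have "map snd (ys[i := apfst D (ys ! i)]) = map snd ys"
        using i by (simp add: map_update list_update_same_conv)
      moreover from this have "snd ` set (ys[i := apfst D (ys ! i)]) = snd ` set ys"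
        by (metis list.set_map)
      then have "\<forall>v\<in>set (ys[i := apfst D (ys ! i)]). 1 \<le> snd v"
        using pos by (metis imageE imageI)
      ultimately have "balanced (ys[i := apfst D (ys ! i)]) (length zs)"
        using bal by (simp add: balanced_def)
      then show "eval_mmonom (mset (zeros zs @ ys[i := apfst D (ys ! i)])) =
          eval_word (ys[i := apfst D (ys ! i)]) zs"
        by (rule eval_mmonom_balanced) simp
    qed
    ultimately show ?thesis
      unfolding mpoly_deriv_mmonom expand slot_sum_append
      by (simp add: derivation_eval_word[OF D bal] eval_mmonom_balanced[OF bal m])
  next
    case False
    then have w: "weight (mset (zeros zs @ ys)) \<noteq> -1" using balanced_iff_weight[OF pos] by blast
    have "slot_sum (apfst D) (\<lambda>l. eval_mmonom (mset l)) (zeros zs @ ys) = 0"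
      unfolding slot_sum_def
      by (intro sum.neutral ballI eval_mmonom_eq_0)
        (use w in \<open>simp add: weight_replace[where k = 0] del: mset_append\<close>)
    then show ?thesis
      using expand w by (simp add: m eval_mmonom_eq_0 lin_zero[OF lD] del: mset_append)
  qed
qed

section \<open>The differential ideal\<close>

definition weight_ge :: "int \<Rightarrow> ('a \<times> nat, 'k) mpoly \<Rightarrow> bool" where
  "weight_ge k p \<longleftrightarrow> (\<forall>m. Poly_Mapping.lookup p m \<noteq> 0 \<longrightarrow> k \<le> weight m)"

lemma weight_ge_0 [simp]: "weight_ge k 0"
  by (simp add: weight_ge_def)

lemma weight_ge_add: "weight_ge k p \<Longrightarrow> weight_ge k q \<Longrightarrow> weight_ge k (p + q)"
  by (auto simp: weight_ge_def lookup_add) (metis add.right_neutral)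

lemma weight_ge_scale: "weight_ge k p \<Longrightarrow> weight_ge k (word_scale c p)"
  by (auto simp: weight_ge_def lookup_word_scale)

lemma weight_ge_diff: "weight_ge k p \<Longrightarrow> weight_ge k q \<Longrightarrow> weight_ge k (p - q)"
  by (auto simp: weight_ge_def lookup_minus) (metis diff_zero)

lemma weight_ge_mmonom: "k \<le> weight m \<Longrightarrow> weight_ge k (mmonom m)"
  by (simp add: weight_ge_def lookup_single when_def)

lemma weight_ge_sum: "(\<And>i. i \<in> A \<Longrightarrow> weight_ge k (g i)) \<Longrightarrow> weight_ge k (sum g A)"
  by (induction A rule: infinite_finite_induct) (auto intro: weight_ge_add)

lemma weight_ge_keysD: "weight_ge k p \<Longrightarrow> m \<in> Poly_Mapping.keys p \<Longrightarrow> k \<le> weight m"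
  by (simp add: weight_ge_def in_keys_iff)

lemma weight_ge_mpoly_deriv:
  assumes "weight_ge k p"
  shows "weight_ge (k + 1) (mpoly_deriv raise p)"
  unfolding mpoly_deriv_def extend_linear_def
proof (intro weight_ge_sum weight_ge_scale)
  fix m assume "m \<in> Poly_Mapping.keys p"
  then have k: "k \<le> weight m" by (rule weight_ge_keysD[OF assms])
  obtain l where l: "m = mset l" by (metis ex_mset)
  show "weight_ge (k + 1) (replace_one raise m)"
    unfolding l replace_one_mset slot_sum_def
    by (intro weight_ge_sum weight_ge_mmonom)
      (use k l in \<open>simp add: weight_raise\<close>)
qed

lemma weight_ge_mmonom_mult:
  assumes "weight_ge k p"
  shows "weight_ge (weight m + k) (mmonom m * p)"
proof -
  have "weight_ge (weight m + k) (mmonom m * (\<Sum>n\<in>Poly_Mapping.keys p. word_scale (Poly_Mapping.lookup p n) (mmonom n)))"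
    unfolding sum_distrib_left mpoly_scale_mult mmonom_mult
    using weight_ge_keysD[OF assms] by (intro weight_ge_sum weight_ge_scale weight_ge_mmonom) simp
  then show ?thesis by (simp only: mmonom_expansion[symmetric])
qed

lemma eval_mpoly_weight_ge_0: "weight_ge 0 p \<Longrightarrow> eval_mpoly p = 0"
  unfolding eval_mpoly_def extend_linear_def
  by (intro sum.neutral ballI) (use weight_ge_keysD[of 0 p] eval_mmonom_eq_0 in fastforce)

lemma eval_mpoly_multiples_eq_0:
  assumes "\<And>m. eval_mpoly (mmonom m * p) = 0"
  shows "eval_mpoly (q * p) = 0"
proof -
  have "eval_mpoly (q * p) = (\<lambda>q. 0) q"
  proof (rule mpoly_linear_eqI[where scale = scale and f = "\<lambda>q. eval_mpoly (q * p)"])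
    show "Vector_Spaces.linear word_scale scale (\<lambda>q. eval_mpoly (q * p))"
      unfolding Vector_Spaces.linear_iff
      by (simp add: vector_space_word_scale vector_space_axioms distrib_right mpoly_scale_mult
          eval_mpoly_add eval_mpoly_scale)
    show "Vector_Spaces.linear word_scale scale (\<lambda>q :: ('a \<times> nat, 'k) mpoly. 0 :: 'a)"
      unfolding Vector_Spaces.linear_iff by (simp add: vector_space_word_scale vector_space_axioms)
  qed (use assms in simp)
  then show ?thesis by simp
qed

text \<open>This is the largest ideal in the kernel of \<open>eval_mpoly\<close> that is stable under \<open>d\<close>.\<close>

definition eval_ideal :: "('a \<times> nat, 'k) mpoly set" where
  "eval_ideal = {p. \<forall>n q. eval_mpoly (q * (mpoly_deriv raise ^^ n) p) = 0}"

text \<open>Derivatives of a relation are reduced to the relation itself. To evaluate \<open>m d(u)\<close>, where \<open>u\<close> is a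
derivative of \<open>p\<close>, split a variable \<open>z\<close> without derivative off \<open>m = z m'\<close>: then
\<open>m d(u) = z d(m' u) - z d(m') u\<close>, where the first term evaluates to \<open>z \<circ> 0\<close> and the second one to 0, by
induction. If \<open>m\<close> has no such variable, then its weight is not negative and \<open>m d(u)\<close> has no part of
weight -1; this is where the bound on the weights of \<open>p\<close> is needed.\<close>

lemma eval_idealI:
  assumes w: "weight_ge (-1) p" and p: "\<And>m. eval_mpoly (mmonom m * p) = 0"
  shows "p \<in> eval_ideal"
proof -
  let ?d = "mpoly_deriv raise :: ('a \<times> nat, 'k) mpoly \<Rightarrow> _"
  have wn: "weight_ge (int n - 1) ((?d ^^ n) p)" for n
  proof (induction n)
    case (Suc n)
    from weight_ge_mpoly_deriv[OF Suc.IH] show ?case by simp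
  qed (use w in simp)
  have "eval_mpoly (mmonom m * (?d ^^ n) p) = 0" for n m
  proof (induction n arbitrary: m)
    case 0
    then show ?case using p by simp
  next
    case (Suc n)
    define u where "u = (?d ^^ n) p"
    have IH: "eval_mpoly (q * u) = 0" for q
      unfolding u_def by (rule eval_mpoly_multiples_eq_0[OF Suc.IH])
    show ?case
    proof (cases "\<exists>z. (z, 0) \<in># m")
      case True
      then obtain z m' where m: "m = add_mset (z, 0) m'" by (meson multi_member_split)
      have "mmonom m = mmonom {#(z, 0)#} * (mmonom m' :: ('a \<times> nat, 'k) mpoly)"
        by (simp add: m mmonom_mult)
      then have "mmonom m * ?d u = mmonom {#(z, 0)#} * ?d (mmonom m' * u) - (mmonom {#(z, 0)#} * ?d (mmonom m')) * u"
        by (simp only: mpoly_deriv_mult distrib_left mult.assoc add_diff_cancel_left')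
      then show ?thesis
        by (simp add: eval_mpoly_diff eval_mpoly_circ IH lin_zero[OF circ_lin_right] flip: u_def
            del: mpoly_deriv_mmonom)
    next
      case False
      then have "0 \<le> weight m"
      proof (induction m)
        case (add v m)
        then have "snd v \<noteq> 0" by (cases v) auto
        with add show ?case by auto
      qed simp
      moreover have "weight_ge (weight m + (int (Suc n) - 1)) (mmonom m * (?d ^^ Suc n) p)"
        by (rule weight_ge_mmonom_mult[OF wn])
      ultimately have "weight_ge 0 (mmonom m * (?d ^^ Suc n) p)"
        by (auto simp: weight_ge_def simp del: funpow.simps)
      then show ?thesis by (rule eval_mpoly_weight_ge_0)
    qed
  qed
  then show ?thesis
    unfolding eval_ideal_def using eval_mpoly_multiples_eq_0 by blast
qed

lemma eval_mmonom_zero_linear: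
  "eval_mmonom (add_mset (scale c x + y, 0) m) =
     scale c (eval_mmonom (add_mset (x, 0) m)) + eval_mmonom (add_mset (y, 0) m)"
proof -
  obtain zs ys where m: "m = mset (zeros zs @ ys)" and pos: "\<forall>v\<in>set ys. 1 \<le> snd v"
    using split_zeros by blast
  show ?thesis
  proof (cases "balanced ys (Suc (length zs))")
    case bal: True
    have e: "eval_mmonom (add_mset (x, 0) m) = eval_word ys (x # zs)" for x
      by (rule eval_mmonom_balanced) (simp_all add: bal m)
    show ?thesis
      unfolding e using eval_word_linear_hd[OF bal] by (simp add: lin_iff)
  next
    case False
    then have "eval_mmonom (add_mset (x, 0) m) = 0" for x
      using balanced_iff_weight[OF pos, of "x # zs"] by (intro eval_mmonom_eq_0) (simp add: m)
    then show ?thesis by simp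
  qed
qed

text \<open>Let \<open>y'\<close> be the first derivative to be absorbed, and \<open>x\<close> the first entry of the stack.\<close>

lemma eval_mmonom_circ:
  "eval_mmonom (add_mset (x, 0) (add_mset (y, 1) m)) = eval_mmonom (add_mset (circ x y, 0) m)"
proof -
  obtain zs ys where m: "m = mset (zeros zs @ ys)" and pos: "\<forall>v\<in>set ys. 1 \<le> snd v"
    using split_zeros by blast
  show ?thesis
  proof (cases "balanced ys (Suc (length zs))")
    case bal: True
    have "eval_mmonom (add_mset (x, 0) (add_mset (y, 1) m)) = eval_word ((y, 1) # ys) (x # zs)"
      by (rule eval_mmonom_balanced) (use bal in \<open>simp_all add: m balanced_def\<close>)
    moreover have "eval_mmonom (add_mset (circ x y, 0) m) = eval_word ys (circ x y # zs)"
      by (rule eval_mmonom_balanced) (use bal in \<open>simp_all add: m\<close>)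
    ultimately show ?thesis by (simp add: extend_op_Cons)
  next
    case False
    then have "weight m \<noteq> 0"
      using balanced_iff_weight[OF pos, of "x # zs"] by (simp add: m)
    then show ?thesis by (simp add: eval_mmonom_eq_0)
  qed
qed

text \<open>The variables \<open>x\<^sup>(\<^sup>0\<^sup>)\<close> embed \<open>A\<close> into the polynomials modulo \<open>eval_ideal\<close>. Linearity in \<open>x\<close> and the relation
for \<open>\<circ>\<close> hold there by \<open>eval_idealI\<close>. Injectivity holds because \<open>x\<^sup>(\<^sup>0\<^sup>)\<close> evaluates to \<open>x\<close>.\<close>

theorem special_GD_algebra_of_derivation:
  assumes D: "derivation_of scale circ D"
  shows "special_GD_algebra scale circ (\<lambda>x y. circ (D x) y - circ (D y) x)"
proof -
  let ?d = "mpoly_deriv raise :: ('a \<times> nat, 'k) mpoly \<Rightarrow> _"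
  let ?\<Delta> = "mpoly_deriv (apfst D) :: ('a \<times> nat, 'k) mpoly \<Rightarrow> _"
  define f :: "'a \<Rightarrow> ('a \<times> nat, 'k) mpoly" where "f x = mmonom {#(x, 0)#}" for x
  have comm: "?\<Delta> (?d p) = ?d (?\<Delta> p)" for p
    by (rule mpoly_deriv_commute) (simp add: raise_def)
  have comm_n: "(?d ^^ n) (?\<Delta> p) = ?\<Delta> ((?d ^^ n) p)" for n p
    by (induction n) (simp_all add: comm)
  have d_n_add: "(?d ^^ n) (p + q) = (?d ^^ n) p + (?d ^^ n) q" for n p q
    by (induction n) (simp_all add: mpoly_deriv_add)
  have d_n_scale: "(?d ^^ n) (word_scale c p) = word_scale c ((?d ^^ n) p)" for n c p
    by (induction n) (simp_all add: mpoly_deriv_scale)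
  have d_n_zero: "(?d ^^ n) 0 = 0" for n
    by (induction n) simp_all
  have I: "eval_mpoly (q * (?d ^^ n) p) = 0" if "p \<in> eval_ideal" for n p q
    using that by (simp add: eval_ideal_def)
  have f_linear: "f (scale c x + y) - (word_scale c (f x) + f y) \<in> eval_ideal" for c x y
  proof (rule eval_idealI)
    show "weight_ge (-1) (f (scale c x + y) - (word_scale c (f x) + f y))"
      unfolding f_def by (intro weight_ge_diff weight_ge_add weight_ge_scale weight_ge_mmonom) simp_all
    show "eval_mpoly (mmonom m * (f (scale c x + y) - (word_scale c (f x) + f y))) = 0" for m
      by (simp add: f_def right_diff_distrib distrib_left mpoly_scale_mult mmonom_mult eval_mpoly_diff
          eval_mpoly_add eval_mpoly_scale eval_mmonom_zero_linear)
  qed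
  have f_circ: "f (circ x y) - f x * ?d (f y) \<in> eval_ideal" for x y
  proof -
    have e: "f x * ?d (f y) = mmonom {#(x, 0), (y, 1)#}"
      by (simp add: f_def replace_one_def raise_def mmonom_mult add_mset_commute)
    show ?thesis
      unfolding e
    proof (rule eval_idealI)
      show "weight_ge (-1) (f (circ x y) - mmonom {#(x, 0), (y, 1)#})"
        unfolding f_def by (intro weight_ge_diff weight_ge_mmonom) simp_all
      show "eval_mpoly (mmonom m * (f (circ x y) - mmonom {#(x, 0), (y, 1)#})) = 0" for m
        using eval_mmonom_circ[of x y m]
        by (simp add: f_def right_diff_distrib mmonom_mult eval_mpoly_diff)
    qed
  qed
  have sub: "W.subspace (eval_ideal :: ('a \<times> nat, 'k) mpoly set)"
    unfolding W.subspace_def eval_ideal_def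
    by (simp add: d_n_add d_n_scale d_n_zero distrib_left mpoly_scale_mult eval_mpoly_add eval_mpoly_scale)
  have f_0: "f 0 \<in> eval_ideal"
    using W.subspace_neg[OF sub f_linear[of 1 0 0]] by simp
  have \<Delta>_f: "?\<Delta> (f x) = f (D x)" for x
    by (simp add: f_def replace_one_def)
  show ?thesis
  proof (rule special_GD_algebra_modulo_ideal[where scaleR = word_scale and d = ?d and \<Delta> = ?\<Delta>
        and I = eval_ideal and f = f])
    show "novikov_algebra scale circ" by (rule novikov_algebra_axioms)
    show "bilinear_op word_scale ((*) :: ('a \<times> nat, 'k) mpoly \<Rightarrow> _)" by (rule bilinear_op_mpoly_mult)
    show "derivation_of word_scale (*) ?d" "derivation_of word_scale (*) ?\<Delta>"
      by (rule derivation_mpoly_deriv)+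
    show "?\<Delta> (?d p) = ?d (?\<Delta> p)" for p by (rule comm)
    show "W.subspace (eval_ideal :: ('a \<times> nat, 'k) mpoly set)" by (rule sub)
    show dI: "?d p \<in> eval_ideal" if "p \<in> eval_ideal" for p
    proof -
      have "eval_mpoly (q * (?d ^^ n) (?d p)) = 0" for n q
        using I[OF that, of q "Suc n"] by (simp add: funpow_swap1)
      then show ?thesis by (simp add: eval_ideal_def)
    qed
    show "?\<Delta> p \<in> eval_ideal" if "p \<in> eval_ideal" for p
    proof -
      have "eval_mpoly (q * (?d ^^ n) (?\<Delta> p)) = 0" for n q
      proof -
        have "q * (?d ^^ n) (?\<Delta> p) = ?\<Delta> (q * (?d ^^ n) p) - ?\<Delta> q * (?d ^^ n) p"
          by (simp add: comm_n mpoly_deriv_mult)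
        then show ?thesis
          using D by (simp add: eval_mpoly_diff eval_mpoly_derivation[OF D] I[OF that]
              derivation_of_def lin_zero)
      qed
      then show ?thesis by (simp add: eval_ideal_def)
    qed
    show "r * p \<in> eval_ideal" if "p \<in> eval_ideal" for p r
    proof -
      have "eval_mpoly (q * (?d ^^ n) (r * p)) = 0" for n q
        using that
      proof (induction n arbitrary: q r p)
        case 0
        then show ?case using I[OF 0, of "q * r" 0] by (simp add: mult.assoc)
      next
        case (Suc n)
        then show ?case
          by (simp add: funpow_swap1 mpoly_deriv_mult d_n_add distrib_left eval_mpoly_add Suc.IH dI
              del: funpow.simps(2) add: funpow_Suc_right)
      qed
      then show ?thesis by (simp add: eval_ideal_def)
    qed
    show "f (x + y) - (f x + f y) \<in> eval_ideal" for x y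
      using f_linear[of 1 x y] by simp
    show "f (scale c x) - word_scale c (f x) \<in> eval_ideal" for c x
      using W.subspace_add[OF sub f_linear[of c x 0] f_0] by simp
    show "x = 0" if "f x \<in> eval_ideal" for x
      using I[OF that, of 1 0] eval_mpoly_generator by (simp add: f_def)
    show "f (circ x y) - f x * ?d (f y) \<in> eval_ideal" for x y by (rule f_circ)
    show "f (circ (D x) y - circ (D y) x) - (?\<Delta> (f x) * ?d (f y) - ?\<Delta> (f y) * ?d (f x)) \<in> eval_ideal" for x y
    proof -
      let ?p = "circ (D x) y" and ?q = "circ (D y) x"
      have "f (?p - ?q) - (f ?p - f ?q) \<in> eval_ideal"
        using f_linear[of "-1" ?q ?p] by (simp add: algebra_simps)
      from W.subspace_add[OF sub this W.subspace_diff[OF sub f_circ[of "D x" y] f_circ[of "D y" x]]]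
      show ?thesis by (simp add: \<Delta>_f algebra_simps)
    qed
  qed
qed

end

theorem proposition5p1:
  fixes scale :: "'k::{alg_closed_field, field_char_0} \<Rightarrow> 'a::ab_group_add \<Rightarrow> 'a"
    and Basis :: "'a set"
    and circ :: "'a \<Rightarrow> 'a \<Rightarrow> 'a"
    and D :: "'a \<Rightarrow> 'a"
  assumes "novikov_algebra scale circ"
    and "finite_dimensional_vector_space scale Basis"
    and "derivation_of scale circ D"
  shows "special_GD_algebra scale circ (\<lambda>x y. circ (D x) y - circ (D y) x)"
proof -
  interpret novikov_algebra scale circ by fact
  show ?thesis using assms(3) by (rule special_GD_algebra_of_derivation)
qed

end
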